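(* Let $\Omega\subset\mathbb{R}^2$, $A$, $V$ and $\mathcal{L}w=-\nabla\cdot(A\nabla w)+Vw$ be as in the context, and let $u$ be the landscape function, i.e. the solution of $\mathcal{L}u=1$ in $\Omega$, $u=0$ on $\partial\Omega$. If $v\in C(\overline{\Omega})$ and $\mathcal{L}v\in L^{\infty}(\Omega)$, then $$|v(x)|\leq \|v\|_{L^\infty(\partial\Omega)}+\|\mathcal{L}v\|_{L^{\infty}(\Omega)}\,u(x)$$ for each $x\in\overline{\Omega}$.
   Context: $\Omega\subset\mathbb{R}^2$ is a bounded polygonal domain with a finite partition $\overline{\Omega}=\bigcup_{k=1}^m\overline{\Omega_k}$ into polygonal subdomains $\Omega_k$, with $\Omega_i\cap\Omega_j=\emptyset$ for $i\neq j$. The real symmetric $2\times 2$ matrix function $A$ and the real-valued potential $V$ are piecewise smooth with respect to this partition (on each $\Omega_k$ they are smooth, with smooth extension to $\overline{\Omega_k}$). Moreover $V\geq 0$ on $\Omega$, and $A$ is uniformly positive definite a.e. on $\Omega$: there is $\alpha>0$ such that $\xi^{t}A(x)\xi\geq\alpha|\xi|^2$ for all $\xi\in\mathbb{R}^2$ and a.e. $x\in\Omega$. The operator $\mathcal{L}w=-\nabla\cdot(A\nabla w)+Vw$ is understood in the weak sense: $\mathcal{L}v\in L^\infty(\Omega)$ means that $v\in H^1_{\mathrm{loc}}(\Omega)$ and there is $f\in L^\infty(\Omega)$ (denoted $\mathcal{L}v$) such that $\int_\Omega \left(A\nabla v\cdot\nabla\varphi+Vv\varphi\right)dx=\int_\Omega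 f\varphi\,dx$ for all $\varphi\in C_c^\infty(\Omega)$. The landscape function $u$ is the unique weak solution in $H_0^1(\Omega)$ of $\mathcal{L}u=1$, taken as its representative in $C(\overline{\Omega})$, which vanishes on $\partial\Omega$. *)

theory Defs
  imports "HOL-Analysis.Analysis" "HOL-Probability.Essential_Supremum"
begin

section \<open>Polygonal domains and partitions\<close>

text \<open>Slits are allowed (the closure of the domain may have a larger interior than the domain), but
  the boundary has no isolated points, since its segments are nondegenerate.\<close>

definition polygonal_domain :: "(real^2) set \<Rightarrow> bool" where
  "polygonal_domain \<Omega> \<longleftrightarrow>
     open \<Omega> \<and> connected \<Omega> \<and> \<Omega> \<noteq> {} \<and> bounded \<Omega> \<and>
     (\<exists>S. finite S \<and> (\<forall>s\<in>S. \<exists>a b. a \<noteq> b \<and> s = closed_segment a b) \<and> frontier \<Omega> = \<Union>S)"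

definition polygonal_partition :: "(real^2) set \<Rightarrow> nat \<Rightarrow> (nat \<Rightarrow> (real^2) set) \<Rightarrow> bool" where
  "polygonal_partition \<Omega> m D \<longleftrightarrow>
     (\<forall>k\<in>{1..m}. polygonal_domain (D k) \<and> D k \<subseteq> \<Omega>) \<and>
     (\<forall>i\<in>{1..m}. \<forall>j\<in>{1..m}. i \<noteq> j \<longrightarrow> D i \<inter> D j = {}) \<and>
     closure \<Omega> = (\<Union>k\<in>{1..m}. closure (D k))"

section \<open>Smooth functions\<close>

definition grad :: "(real^'n \<Rightarrow> real) \<Rightarrow> real^'n \<Rightarrow> real^'n" where
  "grad f x = (\<chi> i. frechet_derivative f (at x) (axis i 1))"

primrec iter_partial :: "'n list \<Rightarrow> (real^'n \<Rightarrow> real) \<Rightarrow> real^'n \<Rightarrow> real" where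
  "iter_partial [] f = f"
| "iter_partial (i # is) f = (\<lambda>x. grad (iter_partial is f) x $ i)"

text \<open>For open \<open>S\<close> this is membership in $C^\infty(S)$: if every iterated partial derivative is
  differentiable at every point of \<open>S\<close>, then every iterated partial derivative is continuous on
  \<open>S\<close>.\<close>

definition smooth_on :: "(real^'n) set \<Rightarrow> (real^'n \<Rightarrow> real) \<Rightarrow> bool" where
  "smooth_on S f \<longleftrightarrow> (\<forall>is. \<forall>x\<in>S. iter_partial is f differentiable (at x))"

text \<open>Membership in $C^\infty(\overline{S})$: \<open>f\<close> is smooth on the open set \<open>S\<close> and each of its
  derivatives extends continuously to the closure. The values of \<open>f\<close> itself on the boundary play
  no role, so that a function may jump across an interface between two subdomains.\<close>

definition smooth_up_to_closure :: "(real^'n) set \<Rightarrow> (real^'n \<Rightarrow> real) \<Rightarrow> bool" where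
  "smooth_up_to_closure S f \<longleftrightarrow>
     smooth_on S f \<and>
     (\<forall>is. \<exists>g. continuous_on (closure S) g \<and> (\<forall>x\<in>S. g x = iter_partial is f x))"

definition test_functions :: "(real^'n) set \<Rightarrow> (real^'n \<Rightarrow> real) set" where
  "test_functions \<Omega> =
     {\<phi>. smooth_on UNIV \<phi> \<and> compact (closure {x. \<phi> x \<noteq> 0}) \<and> closure {x. \<phi> x \<noteq> 0} \<subseteq> \<Omega>}"

section \<open>Lebesgue and Sobolev spaces\<close>

definition L2_on :: "(real^'n) set \<Rightarrow> (real^'n \<Rightarrow> 'b::euclidean_space) \<Rightarrow> bool" where
  "L2_on S f \<longleftrightarrow>
     f \<in> borel_measurable (lebesgue_on S) \<and> integrable (lebesgue_on S) (\<lambda>x. (norm (f x))\<^sup>2)"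

definition L2_loc :: "(real^'n) set \<Rightarrow> (real^'n \<Rightarrow> 'b::euclidean_space) \<Rightarrow> bool" where
  "L2_loc \<Omega> f \<longleftrightarrow> (\<forall>K. compact K \<and> K \<subseteq> \<Omega> \<longrightarrow> L2_on K f)"

definition Linf_on :: "(real^'n) set \<Rightarrow> (real^'n \<Rightarrow> real) \<Rightarrow> bool" where
  "Linf_on \<Omega> f \<longleftrightarrow>
     f \<in> borel_measurable (lebesgue_on \<Omega>) \<and> (\<exists>C. AE x in lebesgue_on \<Omega>. \<bar>f x\<bar> \<le> C)"

definition Linf_norm :: "(real^'n) set \<Rightarrow> (real^'n \<Rightarrow> real) \<Rightarrow> real" where
  "Linf_norm \<Omega> f = real_of_ereal (esssup (lebesgue_on \<Omega>) (\<lambda>x. ereal \<bar>f x\<bar>))"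

text \<open>The null sets of the arclength measure on a boundary that is a finite union of segments:
  the trace on each boundary segment is null in its (constant speed) affine parametrisation.\<close>

definition arclength_null :: "(real^2) set \<Rightarrow> (real^2) set \<Rightarrow> bool" where
  "arclength_null \<Gamma> N \<longleftrightarrow>
     (\<forall>a b. a \<noteq> b \<and> closed_segment a b \<subseteq> \<Gamma> \<longrightarrow>
        {t\<in>{0..1}. linepath a b t \<in> N} \<in> null_sets lebesgue)"

definition Linf_norm_boundary :: "(real^2) set \<Rightarrow> (real^2 \<Rightarrow> real) \<Rightarrow> real" where
  "Linf_norm_boundary \<Omega> v =
     Inf {C. 0 \<le> C \<and> arclength_null (frontier \<Omega>) {x\<in>frontier \<Omega>. \<bar>v x\<bar> > C}}"

definition has_weak_grad ::
  "(real^'n) set \<Rightarrow> (real^'n \<Rightarrow> real) \<Rightarrow> (real^'n \<Rightarrow> real^'n) \<Rightarrow> bool" where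
  "has_weak_grad \<Omega> v g \<longleftrightarrow>
     (\<forall>\<phi>\<in>test_functions \<Omega>. \<forall>i.
        (LINT x|lebesgue_on \<Omega>. v x * grad \<phi> x $ i) = - (LINT x|lebesgue_on \<Omega>. g x $ i * \<phi> x))"

text \<open>The weak gradient is carried along as an explicit argument; it is unique up to null sets.\<close>

definition H1_loc_grad ::
  "(real^'n) set \<Rightarrow> (real^'n \<Rightarrow> real) \<Rightarrow> (real^'n \<Rightarrow> real^'n) \<Rightarrow> bool" where
  "H1_loc_grad \<Omega> v g \<longleftrightarrow> L2_loc \<Omega> v \<and> L2_loc \<Omega> g \<and> has_weak_grad \<Omega> v g"

definition H1_grad ::
  "(real^'n) set \<Rightarrow> (real^'n \<Rightarrow> real) \<Rightarrow> (real^'n \<Rightarrow> real^'n) \<Rightarrow> bool" where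
  "H1_grad \<Omega> v g \<longleftrightarrow> L2_on \<Omega> v \<and> L2_on \<Omega> g \<and> has_weak_grad \<Omega> v g"

text \<open>The closure of $C_c^\infty(\Omega)$ in $H^1(\Omega)$.\<close>

definition H10 :: "(real^'n) set \<Rightarrow> (real^'n \<Rightarrow> real) set" where
  "H10 \<Omega> =
     {v. \<exists>g. H1_grad \<Omega> v g \<and>
        (\<exists>\<phi>. (\<forall>n::nat. \<phi> n \<in> test_functions \<Omega>) \<and>
           (\<lambda>n. LINT x|lebesgue_on \<Omega>. (\<phi> n x - v x)\<^sup>2 + (norm (grad (\<phi> n) x - g x))\<^sup>2)
             \<longlonglongrightarrow> 0)}"

section \<open>The operator and the landscape function\<close>

text \<open>\<open>weak_L_eq \<Omega> A V v f\<close>: $v \in H^1_{\mathrm{loc}}(\Omega)$ and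
  $-\nabla\cdot(A\nabla v) + Vv = f$ weakly in \<open>\<Omega>\<close>.\<close>

definition weak_L_eq ::
  "(real^2) set \<Rightarrow> (real^2 \<Rightarrow> real^2^2) \<Rightarrow> (real^2 \<Rightarrow> real) \<Rightarrow> (real^2 \<Rightarrow> real) \<Rightarrow> (real^2 \<Rightarrow> real) \<Rightarrow> bool"
where
  "weak_L_eq \<Omega> A V v f \<longleftrightarrow>
     (\<exists>g. H1_loc_grad \<Omega> v g \<and>
        (\<forall>\<phi>\<in>test_functions \<Omega>.
           (LINT x|lebesgue_on \<Omega>. (A x *v g x) \<bullet> grad \<phi> x + V x * v x * \<phi> x)
             = (LINT x|lebesgue_on \<Omega>. f x * \<phi> x)))"

definition landscape_function ::
  "(real^2) set \<Rightarrow> (real^2 \<Rightarrow> real^2^2) \<Rightarrow> (real^2 \<Rightarrow> real) \<Rightarrow> (real^2 \<Rightarrow> real) \<Rightarrow> bool" where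
  "landscape_function \<Omega> A V u \<longleftrightarrow>
     u \<in> H10 \<Omega> \<and> weak_L_eq \<Omega> A V u (\<lambda>x. 1) \<and>
     continuous_on (closure \<Omega>) u \<and> (\<forall>x\<in>frontier \<Omega>. u x = 0)"

end

theory Submission
  imports Defs
begin

text \<open>
  Fix a sign \<open>s = 1\<close> or \<open>s = - 1\<close>, let \<open>M\<close> be the norm of \<open>v\<close> on the boundary and \<open>F\<close> the norm of
  the right-hand side, and put \<open>z = s * v - F * u - M\<close>. Then \<open>z \<le> 0\<close> on the boundary, because \<open>u\<close>
  vanishes there, and weakly \<open>- div (A (grad z)) = (s * Lv - F) - V * (s * v - F * u)\<close>. The first term
  on the right is nonpositive almost everywhere; where \<open>z > 0\<close> we have \<open>s * v - F * u > M \<ge> 0\<close>, so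
  there the second term is nonpositive as well. Hence \<open>z\<close> is a weak subsolution of the
  principal part on the set \<open>{z > 0}\<close>, and the maximum principle (\<open>weak_maximum_principle\<close>) gives
  \<open>z \<le> 0\<close>. The two signs together are the claimed bound.

  The textbook proof of the maximum principle tests the inequality with the positive part of
  \<open>z - \<epsilon>\<close>, which calls for a chain rule in Sobolev spaces. It is replaced here by an
  approximation with smooth functions only. Let \<open>\<zeta> k\<close> be mollifications of the positive
  part \<open>Z\<close> of \<open>z\<close>, and let \<open>h t = exp (- 1 / t)\<close> for \<open>t > 0\<close> and \<open>h t = 0\<close> otherwise. For large \<open>k\<close>
  the function \<open>h (\<zeta> k - \<epsilon>)\<close> is a nonnegative test function supported in \<open>{Z \<ge> \<epsilon> / 2}\<close>, with
  gradient \<open>h' (\<zeta> k - \<epsilon>) * grad (\<zeta> k)\<close>. On that compact set \<open>\<zeta> k\<close> tends to \<open>Z\<close> uniformly and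
  \<open>grad (\<zeta> k)\<close> tends to the weak gradient \<open>g\<close> in \<open>L\<^sup>2\<close> (\<open>smooth_approximation\<close>), so in the limit
  the integral of \<open>h' (Z - \<epsilon>) * ((A g) \<bullet> g)\<close> is nonpositive. By ellipticity \<open>h' (Z - \<epsilon>) * g = 0\<close>
  almost everywhere. Finally, integrating \<open>h (\<zeta> k - \<epsilon>)\<close> by parts against a coordinate function shows
  that the integral of \<open>h (Z - \<epsilon>)\<close> is the limit of integrals containing
  \<open>h' (\<zeta> k - \<epsilon>) * grad (\<zeta> k)\<close>, which tend to zero. So \<open>Z \<le> \<epsilon>\<close> for every \<open>\<epsilon> > 0\<close>.

  The \<open>L\<^sup>2\<close> convergence of mollifications rests on the continuity of translations in \<open>L\<^sup>1\<close>
  (\<open>shift_dist_tendsto\<close>), transferred to \<open>L\<^sup>2\<close> by an elementary inequality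
  (\<open>power2_diff_le_signed_square\<close>). The polygonal structure enters twice: it makes the
  interfaces negligible, so that the coefficients are essentially bounded, and it guarantees that
  a continuous function is bounded on the boundary by its essential supremum with respect to
  arclength.
\<close>

section \<open>Smooth functions of several variables\<close>

lemma grad_eq:
  assumes "(f has_derivative f') (at x)"
  shows "grad f x $ i = f' (axis i 1)"
  using frechet_derivative_at[OF assms] by (simp add: grad_def)

lemma has_derivative_grad:
  fixes f :: "real^'n \<Rightarrow> real"
  assumes "f differentiable (at x)"
  shows "(f has_derivative (\<lambda>h. grad f x \<bullet> h)) (at x)"
proof -
  let ?D = "frechet_derivative f (at x)"
  have D: "(f has_derivative ?D) (at x)"
    using assms frechet_derivative_works by blast
  have lin: "linear ?D"
    using D has_derivative_linear by blast
  have "?D h = grad f x \<bullet> h" for h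
  proof -
    have "?D h = ?D (\<Sum>i\<in>UNIV. h $ i *\<^sub>R axis i 1)"
      using basis_expansion[of h] by (simp add: scalar_mult_eq_scaleR)
    also have "\<dots> = (\<Sum>i\<in>UNIV. h $ i *\<^sub>R ?D (axis i 1))"
      using lin by (simp add: linear_sum linear_scale)
    also have "\<dots> = grad f x \<bullet> h"
      by (simp add: grad_def inner_vec_def mult.commute)
    finally show ?thesis .
  qed
  then show ?thesis
    using D by (metis (no_types, lifting) ext)
qed

text \<open>Smoothness speaks of all iterated partial derivatives; this rule reduces it to exhibiting a
  class of differentiable functions that is closed under partial derivatives.\<close>

lemma smooth_on_coinduct:
  assumes "P f"
    and "\<And>f. P f \<Longrightarrow> (\<forall>x\<in>S. f differentiable (at x)) \<and> (\<forall>i. P (\<lambda>x. grad f x $ i))"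
  shows "smooth_on S f"
proof -
  have "P (iter_partial is f)" for "is"
    by (induction "is") (use assms in auto)
  then show ?thesis
    using assms(2) by (auto simp: smooth_on_def)
qed

lemma iter_partial_snoc: "iter_partial (is @ [i]) f = iter_partial is (\<lambda>x. grad f x $ i)"
  by (induction "is") auto

lemma smooth_on_partial: "smooth_on S f \<Longrightarrow> smooth_on S (\<lambda>x. grad f x $ i)"
  unfolding smooth_on_def by (metis iter_partial_snoc)

lemma smooth_on_differentiable: "smooth_on S f \<Longrightarrow> x \<in> S \<Longrightarrow> f differentiable (at x)"
  unfolding smooth_on_def by (metis iter_partial.simps(1))

lemma smooth_on_continuous: "smooth_on UNIV f \<Longrightarrow> continuous_on UNIV f"
  by (meson UNIV_I differentiable_imp_continuous_within continuous_at_imp_continuous_on smooth_on_differentiable)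

text \<open>For \<open>n = 0\<close> this is the standard smooth function that is flat at \<open>0\<close>. The factors \<open>t ^ n\<close>
  are there because the derivative of each member of the family is a linear combination of two
  others, so that smoothness can be proved for all members at once.\<close>

definition flat_exp :: "nat \<Rightarrow> real \<Rightarrow> real" where
  "flat_exp n t = (if t \<le> 0 then 0 else exp (- (1/t)) / t ^ n)"

lemma flat_exp_nonneg [simp]: "0 \<le> flat_exp n t"
  by (simp add: flat_exp_def)

lemma flat_exp_pos: "0 < t \<Longrightarrow> 0 < flat_exp n t"
  by (simp add: flat_exp_def)

lemma flat_exp_eq_0 [simp]: "t \<le> 0 \<Longrightarrow> flat_exp n t = 0"
  by (simp add: flat_exp_def)

lemma flat_exp_tendsto_0: "(flat_exp n \<longlongrightarrow> 0) (at 0)"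
proof -
  \<comment> \<open>Substituting \<open>s = 1 / t\<close> turns this into the decay of \<open>s ^ n * exp (- s)\<close> at infinity.\<close>
  have "((\<lambda>s. s ^ n / exp s) \<longlongrightarrow> (0::real)) at_top"
    by (rule tendsto_power_div_exp_0)
  then have "((\<lambda>t. inverse t ^ n / exp (inverse t)) \<longlongrightarrow> (0::real)) (at_right 0)"
    by (rule filterlim_compose[OF _ filterlim_inverse_at_top_right])
  moreover have "\<forall>\<^sub>F t in at_right 0. inverse t ^ n / exp (inverse t) = flat_exp n t"
    by (auto simp: eventually_at_right_field flat_exp_def exp_minus divide_simps intro!: exI[of _ 1])
  ultimately have "(flat_exp n \<longlongrightarrow> 0) (at_right 0)"
    by (rule Lim_transform_eventually)
  moreover have "(flat_exp n \<longlongrightarrow> 0) (at_left 0)"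
    by (rule tendsto_eventually) (auto simp: eventually_at_left_field intro!: exI[of _ "-1"])
  ultimately show ?thesis
    by (simp add: filterlim_split_at)
qed

lemma flat_exp_deriv:
  "(flat_exp n has_real_derivative flat_exp (n + 2) t - real n * flat_exp (n + 1) t) (at t)"
proof -
  consider "t < 0" | "t = 0" | "t > 0" by linarith
  then show ?thesis
  proof cases
    case 1
    have "((\<lambda>_. 0) has_real_derivative 0) (at t)" by simp
    then have "(flat_exp n has_real_derivative 0) (at t)"
      by (rule has_field_derivative_transform_within_open[where S="{..<0}"])
        (use 1 in auto)
    with 1 show ?thesis by simp
  next
    case 2
    have "((\<lambda>s. flat_exp n s / s) \<longlongrightarrow> 0) (at 0)"
      by (rule Lim_transform_eventually[OF flat_exp_tendsto_0[of "n + 1"]])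
        (auto simp: eventually_at_filter flat_exp_def)
    with 2 show ?thesis
      by (simp add: has_field_derivative_iff)
  next
    case 3
    have "((\<lambda>s. exp (- (1/s)) / s ^ n) has_real_derivative
      (exp (- (1/t)) * (1 / t\<^sup>2)) / t ^ n - exp (- (1/t)) * (real n * t ^ (n - 1)) / (t ^ n * t ^ n)) (at t)"
      using 3 by (auto intro!: derivative_eq_intros simp: power2_eq_square field_simps)
    then have "(flat_exp n has_real_derivative
      (exp (- (1/t)) * (1 / t\<^sup>2)) / t ^ n - exp (- (1/t)) * (real n * t ^ (n - 1)) / (t ^ n * t ^ n)) (at t)"
      by (rule has_field_derivative_transform_within_open[where S="{0<..}"])
        (use 3 in \<open>auto simp: flat_exp_def\<close>)
    moreover have "(exp (- (1/t)) * (1 / t\<^sup>2)) / t ^ n - exp (- (1/t)) * (real n * t ^ (n - 1)) / (t ^ n * t ^ n)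
       = flat_exp (n + 2) t - real n * flat_exp (n + 1) t"
      using 3 by (cases n) (auto simp: flat_exp_def field_simps power_add power2_eq_square)
    ultimately show ?thesis by simp
  qed
qed

lemma flat_exp_continuous: "continuous_on UNIV (flat_exp n)"
  by (meson DERIV_isCont flat_exp_deriv continuous_at_imp_continuous_on)

text \<open>A class of functions large enough for all smooth functions used below, and visibly closed under
  partial derivatives (\<open>smooth_term_step\<close>). Closing up under all operations at once avoids separate
  inductions over iterated partial derivatives for sums, products and compositions.\<close>

inductive smooth_term :: "(real^'n \<Rightarrow> real) \<Rightarrow> bool" where
  base: "smooth_on UNIV f \<Longrightarrow> smooth_term f"
| coord: "smooth_term (\<lambda>x. x $ i)"
| const: "smooth_term (\<lambda>x. c)"
| add: "smooth_term f \<Longrightarrow> smooth_term g \<Longrightarrow> smooth_term (\<lambda>x. f x + g x)"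
| mult: "smooth_term f \<Longrightarrow> smooth_term g \<Longrightarrow> smooth_term (\<lambda>x. f x * g x)"
| flat: "smooth_term f \<Longrightarrow> smooth_term (\<lambda>x. flat_exp n (f x))"

lemma grad_flat_exp:
  assumes "f differentiable (at x)"
  shows "grad (\<lambda>x. flat_exp n (f x)) x $ i =
    (flat_exp (n + 2) (f x) - real n * flat_exp (n + 1) (f x)) * grad f x $ i"
    and "(\<lambda>x. flat_exp n (f x)) differentiable (at x)"
proof -
  have "(flat_exp n \<circ> f has_derivative
     (\<lambda>h. (flat_exp (n + 2) (f x) - real n * flat_exp (n + 1) (f x)) * h) \<circ> (\<lambda>h. grad f x \<bullet> h)) (at x)"
    by (rule diff_chain_at[OF has_derivative_grad[OF assms]])
      (use flat_exp_deriv[of n "f x"] in \<open>simp add: has_field_derivative_def\<close>)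
  then have *: "((\<lambda>x. flat_exp n (f x)) has_derivative
     (\<lambda>h. (flat_exp (n + 2) (f x) - real n * flat_exp (n + 1) (f x)) * (grad f x \<bullet> h))) (at x)"
    by (simp add: o_def)
  show "grad (\<lambda>x. flat_exp n (f x)) x $ i =
    (flat_exp (n + 2) (f x) - real n * flat_exp (n + 1) (f x)) * grad f x $ i"
    using grad_eq[OF *, of i] by (simp add: inner_axis)
  show "(\<lambda>x. flat_exp n (f x)) differentiable (at x)"
    using * differentiable_def by blast
qed

lemma grad_mult:
  fixes f g :: "real^'n \<Rightarrow> real"
  assumes "f differentiable (at x)" "g differentiable (at x)"
  shows "grad (\<lambda>x. f x * g x) x $ i = f x * grad g x $ i + grad f x $ i * g x"
  using grad_eq[OF has_derivative_mult[OF has_derivative_grad[OF assms(1)] has_derivative_grad[OF assms(2)]], of i]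
  by (simp add: inner_axis)

lemma grad_add:
  fixes f g :: "real^'n \<Rightarrow> real"
  assumes "f differentiable (at x)" "g differentiable (at x)"
  shows "grad (\<lambda>x. f x + g x) x $ i = grad f x $ i + grad g x $ i"
  using grad_eq[OF has_derivative_add[OF has_derivative_grad[OF assms(1)] has_derivative_grad[OF assms(2)]], of i]
  by (simp add: inner_axis)

lemma grad_const: "grad (\<lambda>x::real^'n. c) x $ i = 0"
  using grad_eq[OF has_derivative_const, of c x i] by simp

lemma has_derivative_coord: "((\<lambda>x::real^'n. x $ j) has_derivative (\<lambda>h. h $ j)) (at x)"
  by (rule bounded_linear.has_derivative[OF bounded_linear_vec_nth]) (rule has_derivative_ident)

lemma grad_coord: "grad (\<lambda>x::real^'n. x $ j) x $ i = (if i = j then 1 else 0)"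
  using grad_eq[OF has_derivative_coord[of j x], of i] by (simp add: axis_def)

lemma smooth_term_step:
  assumes "smooth_term f"
  shows "(\<forall>x\<in>UNIV. f differentiable (at x)) \<and> (\<forall>i. smooth_term (\<lambda>x. grad f x $ i))"
  using assms
proof induction
  case (base f)
  then show ?case
    by (auto intro: smooth_term.base smooth_on_partial simp: smooth_on_differentiable)
next
  case (coord j)
  show ?case
    by (auto simp: grad_coord differentiable_def intro!: smooth_term.const has_derivative_coord exI)
next
  case (const c)
  show ?case
    by (auto simp: grad_const intro!: smooth_term.const)
next
  case (add f g)
  then show ?case
    by (auto simp: grad_add intro!: smooth_term.add)
next
  case (mult f g)
  then show ?case
    by (auto simp: grad_mult intro!: smooth_term.add smooth_term.mult)
next
  case (flat f n)
  have "(\<lambda>x. grad (\<lambda>x. flat_exp n (f x)) x $ i) =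
     (\<lambda>x. (flat_exp (n + 2) (f x) + (- real n) * flat_exp (n + 1) (f x)) * grad f x $ i)" for i
    using flat by (auto simp: grad_flat_exp)
  moreover have "smooth_term (\<lambda>x. (flat_exp (n + 2) (f x) + (- real n) * flat_exp (n + 1) (f x)) * grad f x $ i)" for i
    using flat by (intro smooth_term.mult smooth_term.add smooth_term.const smooth_term.flat) auto
  ultimately show ?case
    using flat by (auto simp: grad_flat_exp(2))
qed

lemma smooth_term_smooth: "smooth_term f \<Longrightarrow> smooth_on UNIV f"
  by (rule smooth_on_coinduct[where P=smooth_term]) (auto dest: smooth_term_step)

lemma smooth_on_flat_exp: "smooth_on UNIV f \<Longrightarrow> smooth_on UNIV (\<lambda>x. flat_exp n (f x))"
  by (rule smooth_term_smooth[OF smooth_term.flat[OF smooth_term.base]])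

section \<open>Test functions\<close>

lemma test_functionsI:
  fixes \<phi> :: "real^'n \<Rightarrow> real"
  assumes "smooth_on UNIV \<phi>" "compact K" "K \<subseteq> \<Omega>" "\<And>x. x \<notin> K \<Longrightarrow> \<phi> x = 0"
  shows "\<phi> \<in> test_functions \<Omega>"
proof -
  have "closure {x. \<phi> x \<noteq> 0} \<subseteq> K"
    using assms by (intro closure_minimal compact_imp_closed) auto
  then have "compact (closure {x. \<phi> x \<noteq> 0})"
    by (metis assms(2) closed_closure compact_Int_closed inf.absorb_iff2)
  with assms \<open>closure {x. \<phi> x \<noteq> 0} \<subseteq> K\<close> show ?thesis
    by (auto simp: test_functions_def)
qed

lemma test_functionsE:
  fixes \<phi> :: "real^'n \<Rightarrow> real"
  assumes "\<phi> \<in> test_functions \<Omega>"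
  obtains K where "smooth_on UNIV \<phi>" "compact K" "K \<subseteq> \<Omega>" "\<And>x. x \<notin> K \<Longrightarrow> \<phi> x = 0"
    "\<And>x. x \<notin> K \<Longrightarrow> grad \<phi> x = 0"
proof (rule that[of "closure {x. \<phi> x \<noteq> 0}"])
  let ?K = "closure {x. \<phi> x \<noteq> 0}"
  show "smooth_on UNIV \<phi>" "compact ?K" "?K \<subseteq> \<Omega>"
    using assms by (auto simp: test_functions_def)
  show *: "\<phi> x = 0" if "x \<notin> ?K" for x
    using that closure_subset[of "{x. \<phi> x \<noteq> 0}"] by auto
  show "grad \<phi> x = 0" if "x \<notin> ?K" for x
  proof -
    have "((\<lambda>_. 0) has_derivative (\<lambda>_. 0)) (at x)" by simp
    then have "(\<phi> has_derivative (\<lambda>_. 0)) (at x)"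
    proof (rule has_derivative_transform_within_open)
      show "open (- ?K)" by (rule open_Compl) (rule closed_closure)
      show "x \<in> - ?K" using that by blast
      show "0 = \<phi> y" if "y \<in> - ?K" for y
        using *[of y] that by (metis ComplD)
    qed
    then show ?thesis
      by (simp add: vec_eq_iff grad_eq)
  qed
qed

lemma test_functions_partial:
  assumes "\<phi> \<in> test_functions \<Omega>"
  shows "(\<lambda>x. grad \<phi> x $ i) \<in> test_functions \<Omega>"
proof -
  obtain K where K: "smooth_on UNIV \<phi>" "compact K" "K \<subseteq> \<Omega>" "\<And>x. x \<notin> K \<Longrightarrow> grad \<phi> x = 0"
    by (rule test_functionsE[OF assms]) blast
  show ?thesis
    by (rule test_functionsI[OF smooth_on_partial[OF K(1)] K(2,3)]) (simp add: K(4))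
qed

lemma test_functions_smooth: "\<phi> \<in> test_functions \<Omega> \<Longrightarrow> smooth_on UNIV \<phi>"
  by (simp add: test_functions_def)

lemma test_functions_mono: "\<phi> \<in> test_functions S \<Longrightarrow> S \<subseteq> T \<Longrightarrow> \<phi> \<in> test_functions T"
  by (auto simp: test_functions_def)

lemma test_functions_bounded:
  fixes \<phi> :: "real^'n \<Rightarrow> real"
  assumes "\<phi> \<in> test_functions \<Omega>"
  obtains C where "0 \<le> C" "\<And>x. \<bar>\<phi> x\<bar> \<le> C"
proof -
  obtain K where K: "smooth_on UNIV \<phi>" "compact K" "\<And>x. x \<notin> K \<Longrightarrow> \<phi> x = 0"
    by (rule test_functionsE[OF assms]) blast
  have "bounded (\<phi> ` K)"
    using K by (intro compact_imp_bounded compact_continuous_image continuous_on_subset[OF smooth_on_continuous]) auto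
  then obtain C where C: "\<And>x. x \<in> K \<Longrightarrow> \<bar>\<phi> x\<bar> \<le> C"
    by (auto simp: bounded_iff)
  have "\<bar>\<phi> x\<bar> \<le> max C 0" for x
    using C[of x] K(3)[of x] by (cases "x \<in> K") auto
  then show ?thesis
    using that[of "max C 0"] by simp
qed

lemma test_functions_lipschitz:
  fixes \<phi> :: "real^'n \<Rightarrow> real"
  assumes "\<phi> \<in> test_functions \<Omega>"
  obtains L where "0 \<le> L" "\<And>x y. \<bar>\<phi> x - \<phi> y\<bar> \<le> L * norm (x - y)" "\<And>x. norm (grad \<phi> x) \<le> L"
proof -
  have "\<exists>C. 0 \<le> C \<and> (\<forall>x. \<bar>grad \<phi> x $ i\<bar> \<le> C)" for i
    using test_functions_bounded[OF test_functions_partial[OF assms, of i]] by metis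
  then obtain C where C: "\<And>i. 0 \<le> C i" "\<And>i x. \<bar>grad \<phi> x $ i\<bar> \<le> C i"
    by metis
  define L where "L = (\<Sum>i\<in>UNIV. C i)"
  have g: "norm (grad \<phi> x) \<le> L" for x
    unfolding L_def by (rule order_trans[OF norm_le_l1_cart sum_mono]) (use C in auto)
  have "\<bar>\<phi> x - \<phi> y\<bar> \<le> L * norm (x - y)" for x y
  proof -
    have "norm (\<phi> x - \<phi> y) \<le> L * norm (x - y)"
    proof (rule differentiable_bound[of UNIV \<phi> "\<lambda>x h. grad \<phi> x \<bullet> h"])
      show "(\<phi> has_derivative (\<lambda>h. grad \<phi> x \<bullet> h)) (at x)" for x
        using has_derivative_grad[OF smooth_on_differentiable[OF test_functions_smooth[OF assms]]] by simp
      show "onorm (\<lambda>h. grad \<phi> x \<bullet> h) \<le> L" for x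
        by (rule onorm_le) (metis Cauchy_Schwarz_ineq2 g mult_right_mono norm_ge_zero order_trans real_norm_def)
    qed auto
    then show ?thesis by simp
  qed
  moreover have "0 \<le> L" using C by (simp add: L_def sum_nonneg)
  ultimately show ?thesis using g that by blast
qed

lemma test_functions_integrable:
  fixes \<phi> :: "real^'n \<Rightarrow> real"
  assumes "\<phi> \<in> test_functions \<Omega>"
  shows "integrable lborel \<phi>" "\<phi> \<in> borel_measurable borel"
proof -
  obtain K where K: "smooth_on UNIV \<phi>" "compact K" "\<And>x. x \<notin> K \<Longrightarrow> \<phi> x = 0"
    by (rule test_functionsE[OF assms]) blast
  have "integrable lborel (\<lambda>x. indicator K x *\<^sub>R \<phi> x)"
    using K by (intro borel_integrable_compact continuous_on_subset[OF smooth_on_continuous]) auto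
  moreover have "(\<lambda>x. indicator K x *\<^sub>R \<phi> x) = \<phi>"
    using K(3) by (force simp: indicator_def)
  ultimately show "integrable lborel \<phi>" by simp
  show "\<phi> \<in> borel_measurable borel"
    using K smooth_on_continuous borel_measurable_continuous_onI by blast
qed

section \<open>Convolution with test functions\<close>

lemma lborel_reflect: "lborel = distr lborel borel (\<lambda>x. t - x :: 'a::euclidean_space)"
  using lborel_affine[of "-1" t] by (simp add: density_1)

lemma
  fixes f :: "'a::euclidean_space \<Rightarrow> 'b::{banach, second_countable_topology}"
  assumes [measurable]: "f \<in> borel_measurable borel"
  shows integral_reflect_lborel: "(LINT x|lborel. f (t - x)) = (LINT x|lborel. f x)"
    and integrable_reflect_lborel: "integrable lborel (\<lambda>x. f (t - x)) \<longleftrightarrow> integrable lborel f"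
proof -
  show "(LINT x|lborel. f (t - x)) = (LINT x|lborel. f x)"
    by (subst (2) lborel_reflect[of t], subst integral_distr) auto
  show "integrable lborel (\<lambda>x. f (t - x)) \<longleftrightarrow> integrable lborel f"
    by (subst (2) lborel_reflect[of t], subst integrable_distr_eq) auto
qed

lemma
  fixes f :: "'a::euclidean_space \<Rightarrow> 'b::{banach, second_countable_topology}"
  assumes [measurable]: "f \<in> borel_measurable borel"
  shows integral_translate_lborel: "(LINT x|lborel. f (t + x)) = (LINT x|lborel. f x)"
    and integrable_translate_lborel: "integrable lborel (\<lambda>x. f (t + x)) \<longleftrightarrow> integrable lborel f"
proof -
  show "(LINT x|lborel. f (t + x)) = (LINT x|lborel. f x)"
    by (subst (2) lborel_distr_plus[of t, symmetric], subst integral_distr) auto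
  show "integrable lborel (\<lambda>x. f (t + x)) \<longleftrightarrow> integrable lborel f"
    by (subst (2) lborel_distr_plus[of t, symmetric], subst integrable_distr_eq) auto
qed

definition conv :: "(real^'n \<Rightarrow> real) \<Rightarrow> (real^'n \<Rightarrow> real) \<Rightarrow> real^'n \<Rightarrow> real" where
  "conv f \<rho> x = (LINT y|lborel. f y * \<rho> (x - y))"

lemma conv_integrable:
  fixes f \<rho> :: "real^'n \<Rightarrow> real"
  assumes f: "integrable lborel f" and \<rho>: "\<rho> \<in> test_functions S"
  shows "integrable lborel (\<lambda>y. f y * \<rho> (x - y))"
proof -
  obtain C where C: "0 \<le> C" "\<And>x. \<bar>\<rho> x\<bar> \<le> C"
    by (rule test_functions_bounded[OF \<rho>]) blast
  note [measurable] = test_functions_integrable(2)[OF \<rho>]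
  show ?thesis
  proof (rule Bochner_Integration.integrable_bound)
    show "integrable lborel (\<lambda>y. C * f y)"
      using f by simp
    show "AE y in lborel. norm (f y * \<rho> (x - y)) \<le> norm (C * f y)"
    proof (rule AE_I2)
      fix y
      have "\<bar>f y\<bar> * \<bar>\<rho> (x - y)\<bar> \<le> \<bar>f y\<bar> * C"
        by (rule mult_left_mono[OF C(2)]) simp
      then show "norm (f y * \<rho> (x - y)) \<le> norm (C * f y)"
        using C(1) by (simp add: abs_mult mult.commute)
    qed
  qed (use f in measurable)
qed

text \<open>Differentiation under the integral sign. The difference quotients of a test function are
  dominated by its Lipschitz constant, so dominated convergence applies along every sequence of
  increments.\<close>

lemma conv_has_derivative:
  fixes f \<rho> :: "real^'n \<Rightarrow> real"
  assumes f: "integrable lborel f" and \<rho>: "\<rho> \<in> test_functions S"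
  shows "(conv f \<rho> has_derivative (\<lambda>h. (\<chi> i. conv f (\<lambda>x. grad \<rho> x $ i) x) \<bullet> h)) (at x)"
proof -
  obtain L where L: "0 \<le> L" "\<And>x y. \<bar>\<rho> x - \<rho> y\<bar> \<le> L * norm (x - y)" "\<And>x. norm (grad \<rho> x) \<le> L"
    by (rule test_functions_lipschitz[OF \<rho>]) blast
  have [measurable]: "f \<in> borel_measurable borel"
    using f by auto
  note [measurable] = test_functions_integrable(2)[OF \<rho>]
  note gm[measurable] = test_functions_integrable(2)[OF test_functions_partial[OF \<rho>]]
  have gin: "integrable lborel (\<lambda>y. f y * grad \<rho> (x - y) $ i)" for i
    by (rule conv_integrable[OF f test_functions_partial[OF \<rho>]])
  \<comment> \<open>The remainder of the first-order expansion of \<open>\<rho>\<close> at \<open>x - y\<close>; it is \<open>o(norm h)\<close> for each \<open>y\<close> and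
    bounded by \<open>2 * L * norm h\<close> uniformly in \<open>y\<close>.\<close>
  define R where "R h y = \<rho> (x - y + h) - \<rho> (x - y) - grad \<rho> (x - y) \<bullet> h" for h y
  have R_alt: "R h y = \<rho> (x + h - y) - \<rho> (x - y) - (\<Sum>i\<in>UNIV. grad \<rho> (x - y) $ i * h $ i)" for h y
    by (simp add: R_def inner_vec_def algebra_simps)
  have [measurable]: "R h \<in> borel_measurable borel" for h
    unfolding R_alt[abs_def] by measurable
  have R_bound: "\<bar>R h y\<bar> \<le> 2 * L * norm h" for h y
  proof -
    have "\<bar>\<rho> (x - y + h) - \<rho> (x - y)\<bar> \<le> L * norm h"
      using L(2)[of "x - y + h" "x - y"] by simp
    moreover have "\<bar>grad \<rho> (x - y) \<bullet> h\<bar> \<le> L * norm h"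
      by (meson Cauchy_Schwarz_ineq2 L(3) mult_right_mono norm_ge_zero order_trans)
    ultimately show ?thesis by (simp add: R_def)
  qed
  have conv_R: "conv f \<rho> (x + h) - conv f \<rho> x - (\<chi> i. conv f (\<lambda>x. grad \<rho> x $ i) x) \<bullet> h
      = (LINT y|lborel. f y * R h y)" for h
  proof -
    have inner: "(\<chi> i. conv f (\<lambda>x. grad \<rho> x $ i) x) \<bullet> h =
        (LINT y|lborel. (\<Sum>i\<in>UNIV. f y * grad \<rho> (x - y) $ i * h $ i))"
      using gin by (simp add: inner_vec_def conv_def)
    have "conv f \<rho> (x + h) - conv f \<rho> x - (\<chi> i. conv f (\<lambda>x. grad \<rho> x $ i) x) \<bullet> h =
        (LINT y|lborel. f y * \<rho> (x + h - y) - f y * \<rho> (x - y) -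
           (\<Sum>i\<in>UNIV. f y * grad \<rho> (x - y) $ i * h $ i))"
    proof -
      have "integrable lborel (\<lambda>y. f y * \<rho> (x + h - y) - f y * \<rho> (x - y))"
        by (intro Bochner_Integration.integrable_diff conv_integrable[OF f \<rho>])
      moreover have "integrable lborel (\<lambda>y. \<Sum>i\<in>UNIV. f y * grad \<rho> (x - y) $ i * h $ i)"
        by (intro Bochner_Integration.integrable_sum integrable_mult_left gin)
      ultimately show ?thesis
        unfolding inner unfolding conv_def
        by (simp only: Bochner_Integration.integral_diff conv_integrable[OF f \<rho>])
    qed
    also have "\<dots> = (LINT y|lborel. f y * R h y)"
      unfolding R_alt by (simp only: right_diff_distrib sum_distrib_left mult.assoc)
    finally show ?thesis .
  qed
  have "((\<lambda>h. norm (conv f \<rho> (x + h) - conv f \<rho> x - (\<chi> i. conv f (\<lambda>x. grad \<rho> x $ i) x) \<bullet> h) / norm h)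
     \<longlongrightarrow> 0) (at 0)"
    unfolding tendsto_at_iff_sequentially
  proof (intro allI impI)
    fix X :: "nat \<Rightarrow> real^'n"
    assume X: "\<forall>i. X i \<in> UNIV - {0}" "X \<longlonglongrightarrow> 0"
    have Rq: "\<bar>R (X k) y\<bar> / norm (X k) \<le> 2 * L" for k y
      using R_bound[of "X k" y] X(1) by (auto simp: divide_simps mult_ac)
    have "(\<lambda>k. LINT y|lborel. f y * (R (X k) y / norm (X k))) \<longlonglongrightarrow> (LINT y|(lborel :: (real^'n) measure). 0 :: real)"
    proof (rule integral_dominated_convergence[where w="\<lambda>y. 2 * L * \<bar>f y\<bar>"])
      show "AE y in lborel. (\<lambda>k. f y * (R (X k) y / norm (X k))) \<longlonglongrightarrow> 0"
      proof (rule AE_I2)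
        fix y
        have "((\<lambda>h. norm (R h y) / norm h) \<longlongrightarrow> 0) (at 0)"
          using has_derivative_grad[OF smooth_on_differentiable[OF test_functions_smooth[OF \<rho>]], of "x - y"]
          by (simp add: R_def has_derivative_at)
        then have "(\<lambda>k. norm (R (X k) y) / norm (X k)) \<longlonglongrightarrow> 0"
          using X unfolding tendsto_at_iff_sequentially by (simp add: o_def)
        then have "(\<lambda>k. R (X k) y / norm (X k)) \<longlonglongrightarrow> 0"
          by (intro tendsto_norm_zero_cancel[where f="\<lambda>k. R (X k) y / norm (X k)"]) simp
        then show "(\<lambda>k. f y * (R (X k) y / norm (X k))) \<longlonglongrightarrow> 0"
          by (rule tendsto_mult_right_zero)
      qed
      show "AE y in lborel. norm (f y * (R (X k) y / norm (X k))) \<le> 2 * L * \<bar>f y\<bar>" for k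
      proof (rule AE_I2)
        fix y
        show "norm (f y * (R (X k) y / norm (X k))) \<le> 2 * L * \<bar>f y\<bar>"
          using mult_left_mono[OF Rq[of k y], of "\<bar>f y\<bar>"] by (simp add: abs_mult mult_ac)
      qed
    qed (use f in auto)
    then have "(\<lambda>k. \<bar>(LINT y|lborel. f y * R (X k) y) / norm (X k)\<bar>) \<longlonglongrightarrow> 0"
      using tendsto_rabs_zero_iff by fastforce
    then show "((\<lambda>h. norm (conv f \<rho> (x + h) - conv f \<rho> x - (\<chi> i. conv f (\<lambda>x. grad \<rho> x $ i) x) \<bullet> h) / norm h)
        \<circ> X) \<longlonglongrightarrow> 0"
      by (simp add: conv_R o_def)
  qed
  then show ?thesis
    by (simp add: has_derivative_at bounded_linear_inner_right)
qed

lemma grad_conv: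
  fixes f \<rho> :: "real^'n \<Rightarrow> real"
  assumes "integrable lborel f" "\<rho> \<in> test_functions S"
  shows "grad (conv f \<rho>) x $ i = conv f (\<lambda>x. grad \<rho> x $ i) x"
  using grad_eq[OF conv_has_derivative[OF assms], of x i] by (simp add: inner_axis)

lemma smooth_on_conv:
  fixes f \<rho> :: "real^'n \<Rightarrow> real"
  assumes f: "integrable lborel f" and "\<rho> \<in> test_functions S"
  shows "smooth_on UNIV (conv f \<rho>)"
proof (rule smooth_on_coinduct[where P="\<lambda>g. \<exists>\<rho>\<in>test_functions S. g = conv f \<rho>"])
  show "\<exists>\<rho>'\<in>test_functions S. conv f \<rho> = conv f \<rho>'"
    using assms by blast
next
  fix g assume "\<exists>\<rho>\<in>test_functions S. g = conv f \<rho>"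
  then obtain \<rho> where \<rho>: "\<rho> \<in> test_functions S" and g: "g = conv f \<rho>" by blast
  show "(\<forall>x\<in>UNIV. g differentiable at x) \<and> (\<forall>i. \<exists>\<rho>\<in>test_functions S. (\<lambda>x. grad g x $ i) = conv f \<rho>)"
    using conv_has_derivative[OF f \<rho>] grad_conv[OF f \<rho>] test_functions_partial[OF \<rho>]
    unfolding g differentiable_def by blast
qed

text \<open>The integral of a difference quotient vanishes by translation invariance, and the difference
  quotients converge to the partial derivative within a fixed ball.\<close>

lemma integral_partial_test_function:
  fixes \<psi> :: "real^'n \<Rightarrow> real"
  assumes \<psi>: "\<psi> \<in> test_functions S"
  shows "(LINT x|lborel. grad \<psi> x $ i) = 0"
proof -
  obtain K where K: "compact K" "\<And>x. x \<notin> K \<Longrightarrow> \<psi> x = 0"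
    by (rule test_functionsE[OF \<psi>]) blast
  obtain B where B: "\<And>x. x \<in> K \<Longrightarrow> norm x \<le> B"
    using compact_imp_bounded[OF K(1)] by (auto simp: bounded_iff)
  obtain L where L: "0 \<le> L" "\<And>x y. \<bar>\<psi> x - \<psi> y\<bar> \<le> L * norm (x - y)"
    by (rule test_functions_lipschitz[OF \<psi>]) blast
  note [measurable] = test_functions_integrable(2)[OF \<psi>]
    test_functions_integrable(2)[OF test_functions_partial[OF \<psi>]]
  let ?e = "axis i 1 :: real^'n"
  define d where "d k = inverse (real (Suc k))" for k
  have d: "0 < d k" "d k \<le> 1" for k
    by (auto simp: d_def divide_simps)
  define Q where "Q k x = (\<psi> (d k *\<^sub>R ?e + x) - \<psi> x) / d k" for k x
  have Qm[measurable]: "Q k \<in> borel_measurable borel" for k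
    unfolding Q_def[abs_def] by measurable
  have "(\<lambda>k. LINT x|lborel. Q k x) \<longlonglongrightarrow> (LINT x|lborel. grad \<psi> x $ i)"
  proof (rule integral_dominated_convergence[where w="\<lambda>x. L * indicator (cball 0 (B + 1)) x"])
    show "integrable lborel (\<lambda>x::real^'n. L * indicator (cball 0 (B + 1)) x)"
      using emeasure_compact_finite[OF compact_cball, of "0::real^'n" "B + 1"]
      by (intro integrable_mult_right integrable_real_indicator) auto
    show "AE x in lborel. (\<lambda>k. Q k x) \<longlonglongrightarrow> grad \<psi> x $ i"
    proof (rule AE_I2)
      fix x
      have line: "((\<lambda>t. x + t *\<^sub>R ?e) has_derivative (\<lambda>t. t *\<^sub>R ?e)) (at 0)"
        by (auto intro!: derivative_eq_intros)
      have "(\<psi> has_derivative (\<lambda>h. grad \<psi> x \<bullet> h)) (at ((\<lambda>t. x + t *\<^sub>R ?e) 0))"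
        using has_derivative_grad[OF smooth_on_differentiable[OF test_functions_smooth[OF \<psi>]], of x] by simp
      from diff_chain_at[OF line this]
      have "((\<lambda>t. \<psi> (x + t *\<^sub>R ?e)) has_real_derivative grad \<psi> x $ i) (at 0)"
        by (simp add: has_field_derivative_def o_def inner_axis mult_commute_abs)
      then have "((\<lambda>t. (\<psi> (x + t *\<^sub>R ?e) - \<psi> x) / t) \<longlongrightarrow> grad \<psi> x $ i) (at 0)"
        by (simp add: has_field_derivative_iff)
      moreover have "d \<longlonglongrightarrow> 0"
        unfolding d_def by (rule LIMSEQ_inverse_real_of_nat)
      ultimately show "(\<lambda>k. Q k x) \<longlonglongrightarrow> grad \<psi> x $ i"
        using d(1) unfolding tendsto_at_iff_sequentially Q_def
        by (force simp: o_def add.commute less_le)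
    qed
    show "AE x in lborel. norm (Q k x) \<le> L * indicator (cball 0 (B + 1)) x" for k
    proof (rule AE_I2)
      fix x
      show "norm (Q k x) \<le> L * indicator (cball 0 (B + 1)) x"
      proof (cases "x \<in> cball 0 (B + 1)")
        case True
        have "\<bar>\<psi> (d k *\<^sub>R ?e + x) - \<psi> x\<bar> \<le> L * d k"
          using L(2)[of "d k *\<^sub>R ?e + x" x] d[of k] by simp
        then show ?thesis
          using True d[of k] by (simp add: Q_def divide_simps)
      next
        case False
        then have n: "norm x > B + 1" by simp
        have "norm x - norm (d k *\<^sub>R ?e) \<le> norm (d k *\<^sub>R ?e + x)"
          by (metis add.commute norm_diff_ineq)
        then have "norm (d k *\<^sub>R ?e + x) > B"
          using n d[of k] by simp
        then have "x \<notin> K" "d k *\<^sub>R ?e + x \<notin> K"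
          using B n by force+
        then show ?thesis
          using False K(2) by (simp add: Q_def)
      qed
    qed
  qed auto
  moreover have "(LINT x|lborel. Q k x) = 0" for k
  proof -
    have "integrable lborel (\<lambda>x. \<psi> (d k *\<^sub>R ?e + x))"
      by (subst integrable_translate_lborel) (use test_functions_integrable[OF \<psi>] in auto)
    moreover have "(LINT x|lborel. \<psi> (d k *\<^sub>R ?e + x)) = (LINT x|lborel. \<psi> x)"
      by (rule integral_translate_lborel) measurable
    ultimately show ?thesis
      unfolding Q_def using test_functions_integrable(1)[OF \<psi>] by simp
  qed
  ultimately have "(\<lambda>k. 0) \<longlonglongrightarrow> (LINT x|lborel. grad \<psi> x $ i)"
    by simp
  then show ?thesis
    by (simp only: LIMSEQ_const_iff)
qed

section \<open>Mollifiers\<close>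

lemma continuous_AE_eq_0:
  fixes f :: "'a::euclidean_space \<Rightarrow> real"
  assumes f: "continuous_on UNIV f" and AE: "AE x in lborel. f x = 0"
  shows "f x = 0"
proof -
  have "open {x. f x \<noteq> 0}"
    by (rule open_Collect_neq) (use f in auto)
  moreover have "{x. f x \<noteq> 0} \<in> null_sets lborel"
    using AE AE_iff_null_sets[of "{x. f x \<noteq> 0}" lborel] calculation by auto
  then have "negligible {x. f x \<noteq> 0}"
    by (simp add: negligible_iff_null_sets null_sets_completionI)
  ultimately show ?thesis
    using open_not_negligible by blast
qed

definition mollifier :: "real \<Rightarrow> real^'n \<Rightarrow> real" where
  "mollifier \<delta> x = flat_exp 0 (\<delta>\<^sup>2 - (norm x)\<^sup>2) / (LINT y|lborel. flat_exp 0 (\<delta>\<^sup>2 - (norm (y::real^'n))\<^sup>2))"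

lemma smooth_term_sum:
  assumes "finite I" "\<And>i. i \<in> I \<Longrightarrow> smooth_term (f i)"
  shows "smooth_term (\<lambda>x. \<Sum>i\<in>I. f i x)"
  using assms
proof (induction I rule: finite_induct)
  case empty
  show ?case using smooth_term.const[of 0] by simp
next
  case (insert i I)
  then show ?case using smooth_term.add[of "f i" "\<lambda>x. \<Sum>i\<in>I. f i x"] by simp
qed

lemma bump_test_function:
  "(\<lambda>x::real^'n. flat_exp 0 (\<delta>\<^sup>2 - (norm x)\<^sup>2) / c) \<in> test_functions UNIV"
proof (rule test_functionsI)
  have eq: "(\<lambda>x::real^'n. flat_exp 0 (\<delta>\<^sup>2 - (norm x)\<^sup>2) / c)
     = (\<lambda>x. inverse c * flat_exp 0 (\<delta>\<^sup>2 + (\<Sum>i\<in>UNIV. -1 * (x $ i * x $ i))))"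
    by (simp add: power2_norm_eq_inner inner_vec_def sum_negf field_simps)
  show "smooth_on UNIV (\<lambda>x::real^'n. flat_exp 0 (\<delta>\<^sup>2 - (norm x)\<^sup>2) / c)"
    unfolding eq
    by (intro smooth_term_smooth smooth_term.mult smooth_term.flat smooth_term.add smooth_term.const
      smooth_term_sum smooth_term.coord finite)
  show "flat_exp 0 (\<delta>\<^sup>2 - (norm x)\<^sup>2) / c = 0" if "x \<notin> cball 0 \<bar>\<delta>\<bar>" for x :: "real^'n"
  proof -
    have "\<delta>\<^sup>2 \<le> (norm x)\<^sup>2"
      using that abs_le_square_iff[of \<delta> "norm x"] by simp
    then show ?thesis by simp
  qed
qed auto

lemma mollifier_test_function: "mollifier \<delta> \<in> test_functions UNIV"
  unfolding mollifier_def[abs_def] by (rule bump_test_function)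

lemma mollifier_nonneg: "0 \<le> mollifier \<delta> x"
  by (simp add: mollifier_def)

lemma mollifier_eq_0:
  assumes "0 < \<delta>" "\<delta> \<le> norm x"
  shows "mollifier \<delta> x = 0"
  using assms by (simp add: mollifier_def power_mono)

lemma mollifier_integral:
  assumes "0 < \<delta>"
  shows "(LINT x|lborel. mollifier \<delta> (x :: real^'n)) = 1"
proof -
  let ?b = "\<lambda>x::real^'n. flat_exp 0 (\<delta>\<^sup>2 - (norm x)\<^sup>2)"
  have b: "?b \<in> test_functions UNIV"
    using bump_test_function[of \<delta> 1] by simp
  have "(LINT x|lborel. ?b x) \<noteq> 0"
  proof
    assume "(LINT x|lborel. ?b x) = 0"
    then have "AE x in lborel. ?b x = 0"
      using test_functions_integrable(1)[OF b] by (simp add: integral_nonneg_eq_0_iff_AE)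
    then have "?b 0 = 0"
      by (rule continuous_AE_eq_0[OF smooth_on_continuous[OF test_functions_smooth[OF b]]])
    with assms show False
      using flat_exp_pos[of "\<delta>\<^sup>2" 0] by simp
  qed
  then show ?thesis
    by (simp add: mollifier_def)
qed

lemma conv_mollifier_eq:
  fixes f :: "real^'n \<Rightarrow> real"
  assumes [measurable]: "f \<in> borel_measurable borel"
  shows "conv f (mollifier \<delta>) x = (LINT y|lborel. mollifier \<delta> y * f (x - y))"
proof -
  note [measurable] = test_functions_integrable(2)[OF mollifier_test_function]
  have "(LINT y|lborel. mollifier \<delta> y * f (x - y)) = (LINT y|lborel. (\<lambda>y. f y * mollifier \<delta> (x - y)) (x - y))"
    by (simp add: mult.commute)
  also have "\<dots> = conv f (mollifier \<delta>) x"
    unfolding conv_def by (rule integral_reflect_lborel) measurable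
  finally show ?thesis by simp
qed

text \<open>A mollification at \<open>x\<close> is an average of the values of \<open>f\<close> within distance \<open>\<delta>\<close> of \<open>x\<close>.\<close>

lemma conv_mollifier_approx:
  fixes f :: "real^'n \<Rightarrow> real"
  assumes f: "integrable lborel f" and \<delta>: "0 < \<delta>"
    and e: "\<And>y. norm y < \<delta> \<Longrightarrow> \<bar>f (x - y) - f x\<bar> \<le> e"
  shows "\<bar>conv f (mollifier \<delta>) x - f x\<bar> \<le> e"
proof -
  have [measurable]: "f \<in> borel_measurable borel" using f by auto
  note m[measurable] = test_functions_integrable(2)[OF mollifier_test_function]
  have mi: "integrable lborel (mollifier \<delta> :: real^'n \<Rightarrow> real)"
    by (rule test_functions_integrable(1)[OF mollifier_test_function])
  have int: "integrable lborel (\<lambda>y. mollifier \<delta> y * f (x - y))"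
    using conv_integrable[OF f mollifier_test_function[of \<delta>], of x]
      integrable_reflect_lborel[of "\<lambda>y. f y * mollifier \<delta> (x - y)" x]
    by (simp add: mult.commute)
  have "conv f (mollifier \<delta>) x - f x = (LINT y|lborel. mollifier \<delta> y * (f (x - y) - f x))"
    using int mi mollifier_integral[OF \<delta>, where 'n='n]
    by (simp add: conv_mollifier_eq right_diff_distrib)
  also have "\<bar>\<dots>\<bar> \<le> (LINT y|(lborel :: (real^'n) measure). mollifier \<delta> y * e)"
  proof -
    have "norm (mollifier \<delta> y * (f (x - y) - f x)) \<le> mollifier \<delta> y * e" for y
      using e[of y] mollifier_eq_0[OF \<delta>, of y] mollifier_nonneg[of \<delta> y]
      by (cases "norm y < \<delta>") (auto simp: abs_mult intro!: mult_left_mono)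
    moreover have "integrable lborel (\<lambda>y. mollifier \<delta> y * (f (x - y) - f x))"
      using int mi by (simp add: right_diff_distrib)
    ultimately show ?thesis
      using mi by (intro Bochner_Integration.integral_abs_bound_integral integrable_mult_left) auto
  qed
  also have "\<dots> = e"
    using mi mollifier_integral[OF \<delta>, where 'n='n] by simp
  finally show ?thesis .
qed

section \<open>Mollification of square integrable functions\<close>

abbreviation shift_dist :: "('a::euclidean_space \<Rightarrow> real) \<Rightarrow> 'a \<Rightarrow> real" where
  "shift_dist f t \<equiv> (LINT x|lborel. \<bar>f (x - t) - f x\<bar>)"

lemma
  fixes f :: "'a::euclidean_space \<Rightarrow> real"
  assumes "integrable lborel f"
  shows integrable_shift: "integrable lborel (\<lambda>x. f (x - t))"
    and integral_shift: "(LINT x|lborel. f (x - t)) = (LINT x|lborel. f x)"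
  using assms integrable_translate_lborel[of f "- t"] integral_translate_lborel[of f "- t"] by auto

text \<open>Translations are isometries of \<open>L\<^sup>1\<close>. Therefore the functions that are translation continuous
  in \<open>L\<^sup>1\<close> form a closed subset of \<open>L\<^sup>1\<close>, which is \<open>shift_dist_tendsto_approx\<close>.\<close>

lemma shift_dist_approx:
  fixes f g :: "'a::euclidean_space \<Rightarrow> real"
  assumes f: "integrable lborel f" and g: "integrable lborel g"
  shows "shift_dist f t \<le> shift_dist g t + 2 * (LINT x|lborel. \<bar>f x - g x\<bar>)"
proof -
  let ?h = "\<lambda>x. \<bar>f x - g x\<bar>"
  have h: "integrable lborel ?h" using f g by auto
  have "shift_dist f t \<le> (LINT x|lborel. \<bar>g (x - t) - g x\<bar> + (?h (x - t) + ?h x))"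
    by (rule Bochner_Integration.integral_mono)
      (use f g h integrable_shift[OF f, of t] integrable_shift[OF g, of t] integrable_shift[OF h, of t] in auto)
  also have "\<dots> = shift_dist g t + ((LINT x|lborel. ?h (x - t)) + (LINT x|lborel. ?h x))"
    using f g h integrable_shift[OF g, of t] integrable_shift[OF h, of t] by simp
  also have "(LINT x|lborel. ?h (x - t)) = (LINT x|lborel. ?h x)"
    by (rule integral_shift[OF h])
  finally show ?thesis by simp
qed

lemma shift_dist_tendsto_approx:
  fixes f :: "'a::euclidean_space \<Rightarrow> real"
  assumes f: "integrable lborel f"
    and approx: "\<And>e. 0 < e \<Longrightarrow> \<exists>g. integrable lborel g \<and> (shift_dist g \<longlongrightarrow> 0) (at 0) \<and>
      (LINT x|lborel. \<bar>f x - g x\<bar>) < e"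
  shows "(shift_dist f \<longlongrightarrow> 0) (at 0)"
proof (rule order_tendstoI)
  fix a :: real assume "a < 0"
  then show "eventually (\<lambda>t. a < shift_dist f t) (at 0)"
    by (intro always_eventually allI less_le_trans[OF _ integral_nonneg_AE]) auto
next
  fix a :: real assume a: "0 < a"
  obtain g where g: "integrable lborel g" "(shift_dist g \<longlongrightarrow> 0) (at 0)"
    "(LINT x|lborel. \<bar>f x - g x\<bar>) < a / 4"
    using approx[of "a / 4"] a by auto
  have "eventually (\<lambda>t. shift_dist g t < a / 2) (at 0)"
    using a by (intro order_tendstoD(2)[OF g(2)]) simp
  then show "eventually (\<lambda>t. shift_dist f t < a) (at 0)"
  proof eventually_elim
    case (elim t)
    then show ?case using shift_dist_approx[OF f g(1), of t] g(3) by linarith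
  qed
qed

text \<open>For an open set, \<open>indicator U (x - t)\<close> tends to \<open>1\<close> at each point \<open>x\<close> of \<open>U\<close>. The mass that leaves
  \<open>U\<close> therefore vanishes in the limit, and the mass that enters is the same, because the
  translated set has the same measure.\<close>

lemma shift_dist_open:
  fixes U :: "'a::euclidean_space set"
  assumes U: "open U" "emeasure lborel U < \<infinity>"
  shows "(shift_dist (indicator U) \<longlongrightarrow> 0) (at 0)"
  unfolding tendsto_at_iff_sequentially
proof (intro allI impI)
  fix X :: "nat \<Rightarrow> 'a"
  assume X: "\<forall>i. X i \<in> UNIV - {0}" "X \<longlonglongrightarrow> 0"
  let ?i = "indicat_real U"
  have [measurable]: "U \<in> sets borel" using U by simp
  have i: "integrable lborel ?i"
    using U by (intro integrable_real_indicator) auto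
  have prod: "integrable lborel (\<lambda>x. ?i x * ?i (x - t))" for t
    by (rule Bochner_Integration.integrable_bound[OF i]) (auto simp: indicator_def)
  have eq: "shift_dist ?i t = 2 * (LINT x|lborel. ?i x) - 2 * (LINT x|lborel. ?i x * ?i (x - t))" for t
  proof -
    have "shift_dist ?i t = (LINT x|lborel. ?i (x - t) + ?i x - 2 * (?i x * ?i (x - t)))"
      by (rule Bochner_Integration.integral_cong) (auto simp: indicator_def)
    also have "\<dots> = (LINT x|lborel. ?i (x - t)) + (LINT x|lborel. ?i x) - 2 * (LINT x|lborel. ?i x * ?i (x - t))"
      using i integrable_shift[OF i, of t] prod[of t] by simp
    finally show ?thesis using integral_shift[OF i, of t] by simp
  qed
  have "(\<lambda>k. LINT x|lborel. ?i x * ?i (x - X k)) \<longlonglongrightarrow> (LINT x|lborel. ?i x)"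
  proof (rule integral_dominated_convergence[where w="?i"])
    show "AE x in lborel. (\<lambda>k. ?i x * ?i (x - X k)) \<longlonglongrightarrow> ?i x"
    proof (rule AE_I2)
      fix x
      show "(\<lambda>k. ?i x * ?i (x - X k)) \<longlonglongrightarrow> ?i x"
      proof (cases "x \<in> U")
        case True
        have "(\<lambda>k. x - X k) \<longlonglongrightarrow> x - 0"
          using X(2) by (intro tendsto_intros)
        then have "eventually (\<lambda>k. x - X k \<in> U) sequentially"
          using True U(1) by (simp add: topological_tendstoD)
        then have "eventually (\<lambda>k. ?i x * ?i (x - X k) = ?i x) sequentially"
          by eventually_elim simp
        then show ?thesis by (rule tendsto_eventually)
      qed simp
    qed
  qed (use i in \<open>auto simp: indicator_def\<close>)
  then have "(\<lambda>k. 2 * (LINT x|lborel. ?i x) - 2 * (LINT x|lborel. ?i x * ?i (x - X k)))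
     \<longlonglongrightarrow> 2 * (LINT x|lborel. ?i x) - 2 * (LINT x|lborel. ?i x)"
    by (intro tendsto_intros)
  then show "(shift_dist ?i \<circ> X) \<longlonglongrightarrow> 0"
    unfolding o_def eq by simp
qed

text \<open>Continuity of translations in \<open>L\<^sup>1\<close>, by induction over integrable functions: outer regularity
  reduces indicators of measurable sets to indicators of open sets, and limits are covered by
  \<open>shift_dist_tendsto_approx\<close>.\<close>

lemma shift_dist_tendsto:
  fixes f :: "'a::euclidean_space \<Rightarrow> real"
  assumes "integrable lborel f"
  shows "(shift_dist f \<longlongrightarrow> 0) (at 0)"
  using assms
proof (induction rule: integrable_induct)
  case (base A c)
  have A: "A \<in> sets lebesgue" "A \<in> sets lborel" using base by auto
  have iA: "integrable lborel (indicat_real A)"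
    using base by (intro integrable_real_indicator) auto
  have "(shift_dist (indicat_real A) \<longlongrightarrow> 0) (at 0)"
  proof (rule shift_dist_tendsto_approx[OF iA])
    fix e :: real assume e: "0 < e"
    obtain U where U: "open U" "A \<subseteq> U" "U - A \<in> lmeasurable" "emeasure lebesgue (U - A) < ennreal e"
      using sets_lebesgue_outer_open[OF A(1) e] by metis
    have [measurable]: "U \<in> sets borel" "A \<in> sets borel" using U A by auto
    have UA: "emeasure lborel (U - A) < ennreal e"
      using U(4) by simp
    have "emeasure lborel U \<le> emeasure lborel A + emeasure lborel (U - A)"
      using emeasure_subadditive[of A lborel "U - A"] U(2) by (simp add: Un_absorb1)
    also have "\<dots> < \<infinity>"
      using base UA by (simp add: less_top[symmetric] top_unique) (metis ennreal_less_top order_less_trans less_irrefl)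
    finally have fin: "emeasure lborel U < \<infinity>" .
    have iU: "integrable lborel (indicat_real U)"
      using fin by (intro integrable_real_indicator) auto
    have "(LINT x|lborel. \<bar>indicat_real A x - indicat_real U x\<bar>) = (LINT x|lborel. indicat_real (U - A) x)"
      by (rule Bochner_Integration.integral_cong) (use U(2) in \<open>auto simp: indicator_def\<close>)
    also have "\<dots> = measure lborel (U - A)"
      by simp
    also have "\<dots> < e"
      using UA e unfolding measure_def
      by (cases "emeasure lborel (U - A)") (auto simp: ennreal_less_iff)
    finally show "\<exists>g. integrable lborel g \<and> (shift_dist g \<longlongrightarrow> 0) (at 0) \<and>
        (LINT x|lborel. \<bar>indicat_real A x - g x\<bar>) < e"
      using iU shift_dist_open[OF U(1) fin] by blast
  qed
  then have "((\<lambda>t. \<bar>c\<bar> * shift_dist (indicat_real A) t) \<longlongrightarrow> 0) (at 0)"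
    by (rule tendsto_mult_right_zero)
  moreover have "\<bar>c\<bar> * shift_dist (indicat_real A) t = shift_dist (\<lambda>x. indicat_real A x *\<^sub>R c) t" for t
    unfolding integral_mult_right_zero[symmetric] abs_mult[symmetric]
    by (simp add: right_diff_distrib mult.commute)
  ultimately show ?case by simp
next
  case (add f g)
  show ?case
  proof (rule Lim_null_comparison)
    show "((\<lambda>t. shift_dist f t + shift_dist g t) \<longlongrightarrow> 0) (at 0)"
      using tendsto_add[OF add.IH] by simp
    show "\<forall>\<^sub>F t in at 0. norm (shift_dist (\<lambda>x. f x + g x) t) \<le> shift_dist f t + shift_dist g t"
    proof (rule always_eventually, rule allI)
      fix t
      have int: "integrable lborel (\<lambda>x. \<bar>f (x - t) - f x\<bar>)" "integrable lborel (\<lambda>x. \<bar>g (x - t) - g x\<bar>)"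
        using add.hyps integrable_shift[of f t] integrable_shift[of g t] by auto
      have "shift_dist (\<lambda>x. f x + g x) t \<le> (LINT x|lborel. \<bar>f (x - t) - f x\<bar> + \<bar>g (x - t) - g x\<bar>)"
        by (rule Bochner_Integration.integral_mono)
          (use int add.hyps integrable_shift[of f t] integrable_shift[of g t] in auto)
      then show "norm (shift_dist (\<lambda>x. f x + g x) t) \<le> shift_dist f t + shift_dist g t"
        using int by (simp add: abs_of_nonneg)
    qed
  qed
next
  case (lim f s)
  show ?case
  proof (rule shift_dist_tendsto_approx)
    fix e :: real assume e: "0 < e"
    have "(\<lambda>i. LINT x|lborel. \<bar>f x - s i x\<bar>) \<longlonglongrightarrow> (LINT x|(lborel :: 'a measure). 0 :: real)"
    proof (rule integral_dominated_convergence[where w="\<lambda>x. 3 * \<bar>f x\<bar>"])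
      show "AE x in lborel. (\<lambda>i. \<bar>f x - s i x\<bar>) \<longlonglongrightarrow> 0"
      proof (rule AE_I2)
        fix x
        have "(\<lambda>i. \<bar>f x - s i x\<bar>) \<longlonglongrightarrow> \<bar>f x - f x\<bar>"
          using lim.hyps(2)[of x] by (intro tendsto_intros) simp
        then show "(\<lambda>i. \<bar>f x - s i x\<bar>) \<longlonglongrightarrow> 0" by simp
      qed
      show "AE x in lborel. norm \<bar>f x - s i x\<bar> \<le> 3 * \<bar>f x\<bar>" for i
      proof (rule AE_I2)
        fix x
        show "norm \<bar>f x - s i x\<bar> \<le> 3 * \<bar>f x\<bar>"
          using lim.hyps(3)[of x i] by simp
      qed
    qed (use lim.hyps in auto)
    then have "eventually (\<lambda>i. (LINT x|lborel. \<bar>f x - s i x\<bar>) < e) sequentially"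
      using e by (intro order_tendstoD(2)) auto
    then obtain i where "(LINT x|lborel. \<bar>f x - s i x\<bar>) < e"
      by (auto simp: eventually_sequentially)
    then show "\<exists>g. integrable lborel g \<and> (shift_dist g \<longlongrightarrow> 0) (at 0) \<and> (LINT x|lborel. \<bar>f x - g x\<bar>) < e"
      using lim by blast
  qed (use lim in auto)
qed

text \<open>The map \<open>G \<mapsto> G * \<bar>G\<bar>\<close> sends \<open>L\<^sup>2\<close> to \<open>L\<^sup>1\<close>, and this inequality bounds the squared \<open>L\<^sup>2\<close> distance
  of two functions by the \<open>L\<^sup>1\<close> distance of their images. Translation continuity in \<open>L\<^sup>2\<close> thus
  follows from \<open>L\<^sup>1\<close> without a separate density argument.\<close>

lemma power2_diff_le_signed_square:
  fixes a b :: real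
  shows "(a - b)\<^sup>2 \<le> 2 * \<bar>a * \<bar>a\<bar> - b * \<bar>b\<bar>\<bar>"
proof -
  have same: "(p - q)\<^sup>2 \<le> 2 * \<bar>p\<^sup>2 - q\<^sup>2\<bar>" if "0 \<le> p" "0 \<le> q" for p q :: real
  proof -
    have "(p - q)\<^sup>2 = \<bar>p - q\<bar> * \<bar>p - q\<bar>"
      by (simp add: power2_eq_square)
    also have "\<dots> \<le> \<bar>p - q\<bar> * \<bar>p + q\<bar>"
      using that by (intro mult_left_mono) auto
    also have "\<dots> = \<bar>p\<^sup>2 - q\<^sup>2\<bar>"
      by (simp add: power2_eq_square algebra_simps flip: abs_mult)
    finally show ?thesis by (rule order_trans) simp
  qed
  have opp: "(p + q)\<^sup>2 \<le> 2 * (p\<^sup>2 + q\<^sup>2)" for p q :: real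
    using sum_squares_ge_zero[of "p - q" 0] by (simp add: power2_eq_square algebra_simps)
  consider "0 \<le> a" "0 \<le> b" | "a \<le> 0" "b \<le> 0" | "0 \<le> a" "b \<le> 0" | "a \<le> 0" "0 \<le> b"
    by linarith
  then show ?thesis
  proof cases
    case 1
    then show ?thesis using same[of a b] by (simp add: power2_eq_square)
  next
    case 2
    then have "a * \<bar>a\<bar> - b * \<bar>b\<bar> = - (a * a - b * b)"
      by simp
    then have "\<bar>a * \<bar>a\<bar> - b * \<bar>b\<bar>\<bar> = \<bar>a * a - b * b\<bar>"
      by (simp only: abs_minus_cancel)
    moreover have "(a - b)\<^sup>2 = (- a - - b)\<^sup>2"
      by (simp add: power2_commute)
    ultimately show ?thesis
      using 2 same[of "-a" "-b"] by (simp add: power2_eq_square)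
  next
    case 3
    then have "0 \<le> a * a" "0 \<le> b * b" by simp_all
    with 3 show ?thesis using opp[of a "-b"] by (simp add: power2_eq_square)
  next
    case 4
    then have "0 \<le> a * a" "0 \<le> b * b" by simp_all
    with 4 show ?thesis using opp[of "-a" b]
      by (simp add: power2_eq_square abs_if algebra_simps)
  qed
qed

text \<open>By Jensen's inequality for the probability density \<open>mollifier \<delta>\<close>, the squared error at \<open>x\<close> is at
  most the average of \<open>(G (x - y) - G x)\<^sup>2\<close> over small \<open>y\<close>. Integrating over \<open>x\<close> first, by Tonelli,
  leaves an average of translation distances.\<close>

lemma mollification_L2:
  fixes G :: "real^'n \<Rightarrow> real"
  assumes G: "integrable lborel G" and G2: "integrable lborel (\<lambda>x. (G x)\<^sup>2)" and e: "0 < e"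
  obtains d where "0 < d"
    "\<And>\<delta>. 0 < \<delta> \<Longrightarrow> \<delta> < d \<Longrightarrow> integrable lborel (\<lambda>x. (conv G (mollifier \<delta>) x - G x)\<^sup>2)"
    "\<And>\<delta>. 0 < \<delta> \<Longrightarrow> \<delta> < d \<Longrightarrow> (LINT x|lborel. (conv G (mollifier \<delta>) x - G x)\<^sup>2) \<le> e"
proof -
  have [measurable]: "G \<in> borel_measurable borel" using G by auto
  define H where "H x = G x * \<bar>G x\<bar>" for x
  have [measurable]: "H \<in> borel_measurable borel" unfolding H_def[abs_def] by measurable
  have H: "integrable lborel H"
    by (rule Bochner_Integration.integrable_bound[OF G2]) (auto simp: H_def power2_eq_square abs_mult)
  have "eventually (\<lambda>t. shift_dist H t < e / 2) (at 0)"
    using e by (intro order_tendstoD(2)[OF shift_dist_tendsto[OF H]]) simp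
  then obtain d where d: "0 < d" "\<And>t. t \<noteq> 0 \<Longrightarrow> norm t < d \<Longrightarrow> shift_dist H t < e / 2"
    by (auto simp: eventually_at)
  have small: "shift_dist H t \<le> e / 2" if "norm t < d" for t
    using d(2)[of t] that e by (cases "t = 0") auto
  {
    fix \<delta> :: real assume \<delta>: "0 < \<delta>" "\<delta> < d"
    let ?m = "mollifier \<delta> :: real^'n \<Rightarrow> real"
    have m: "?m \<in> test_functions UNIV" by (rule mollifier_test_function)
    note [measurable] = test_functions_integrable(2)[OF m]
    note mi = test_functions_integrable(1)[OF m]
    have [measurable]: "conv G ?m \<in> borel_measurable borel"
      by (intro borel_measurable_continuous_onI smooth_on_continuous smooth_on_conv[OF G m])
    have int1: "integrable lborel (\<lambda>y. ?m y * g (x - y))" if "integrable lborel g" for g x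
    proof -
      have [measurable]: "g \<in> borel_measurable borel" using that by auto
      show ?thesis
        using conv_integrable[OF that m, of x]
          integrable_reflect_lborel[of "\<lambda>y. g y * ?m (x - y)" x] by (simp add: mult.commute)
    qed
    have pointwise: "(conv G ?m x - G x)\<^sup>2 \<le> (LINT y|lborel. ?m y * (2 * \<bar>H (x - y) - H x\<bar>))"
      and intH: "integrable lborel (\<lambda>y. ?m y * (2 * \<bar>H (x - y) - H x\<bar>))" for x
    proof -
      define D where "D y = G (x - y) - G x" for y
      have [measurable]: "D \<in> borel_measurable borel" unfolding D_def[abs_def] by measurable
      have mD: "integrable lborel (\<lambda>y. ?m y * D y)"
        unfolding D_def right_diff_distrib using int1[OF G, of x] mi by simp
      have a: "conv G ?m x - G x = (LINT y|lborel. ?m y * D y)"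
        unfolding D_def right_diff_distrib conv_mollifier_eq[OF \<open>G \<in> borel_measurable borel\<close>]
        using int1[OF G, of x] mi mollifier_integral[OF \<delta>(1), where 'n='n] by simp
      have mG2: "integrable lborel (\<lambda>y. ?m y * (G (x - y))\<^sup>2)"
        by (rule int1[OF G2])
      have "integrable lborel (\<lambda>y. ?m y * (G (x - y))\<^sup>2 - 2 * G x * (?m y * G (x - y)) + (G x)\<^sup>2 * ?m y)"
        using mG2 int1[OF G, of x] mi by simp
      then have mD2: "integrable lborel (\<lambda>y. ?m y * (D y)\<^sup>2)"
        by (simp add: D_def power2_diff algebra_simps)
      \<comment> \<open>Jensen's inequality, from the nonnegativity of the variance of \<open>D\<close>.\<close>
      define c where "c = (LINT y|lborel. ?m y * D y)"
      have "0 \<le> (LINT y|lborel. ?m y * (D y - c)\<^sup>2)"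
        by (intro integral_nonneg_AE AE_I2) (simp add: mollifier_nonneg)
      also have "\<dots> = (LINT y|lborel. ?m y * (D y)\<^sup>2 - 2 * c * (?m y * D y) + c\<^sup>2 * ?m y)"
        by (simp add: power2_diff algebra_simps)
      also have "\<dots> = (LINT y|lborel. ?m y * (D y)\<^sup>2) - 2 * c * (LINT y|lborel. ?m y * D y) + c\<^sup>2 * 1"
        using mD mD2 mi mollifier_integral[OF \<delta>(1), where 'n='n] by simp
      finally have jensen: "c\<^sup>2 \<le> (LINT y|lborel. ?m y * (D y)\<^sup>2)"
        by (simp add: c_def[symmetric] power2_eq_square)
      have "integrable lborel (\<lambda>y. \<bar>?m y * H (x - y) - ?m y * H x\<bar>)"
        using int1[OF H, of x] mi by simp
      moreover have "\<bar>?m y * H (x - y) - ?m y * H x\<bar> = ?m y * \<bar>H (x - y) - H x\<bar>" for y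
        by (simp add: mollifier_nonneg abs_mult flip: right_diff_distrib)
      ultimately have "integrable lborel (\<lambda>y. 2 * (?m y * \<bar>H (x - y) - H x\<bar>))"
        by simp
      then show intH: "integrable lborel (\<lambda>y. ?m y * (2 * \<bar>H (x - y) - H x\<bar>))"
        by (simp add: mult.left_commute)
      have "(LINT y|lborel. ?m y * (D y)\<^sup>2) \<le> (LINT y|lborel. ?m y * (2 * \<bar>H (x - y) - H x\<bar>))"
        by (rule Bochner_Integration.integral_mono[OF mD2 intH])
          (auto simp: D_def H_def mollifier_nonneg intro!: mult_left_mono power2_diff_le_signed_square)
      with jensen show "(conv G ?m x - G x)\<^sup>2 \<le> (LINT y|lborel. ?m y * (2 * \<bar>H (x - y) - H x\<bar>))"
        by (simp add: a c_def)
    qed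
    have "(\<integral>\<^sup>+x. ennreal ((conv G ?m x - G x)\<^sup>2) \<partial>lborel)
        \<le> (\<integral>\<^sup>+x. \<integral>\<^sup>+y. ennreal (?m y * (2 * \<bar>H (x - y) - H x\<bar>)) \<partial>lborel \<partial>lborel)"
    proof (rule nn_integral_mono)
      fix x
      have "(\<integral>\<^sup>+y. ennreal (?m y * (2 * \<bar>H (x - y) - H x\<bar>)) \<partial>lborel) =
          ennreal (LINT y|lborel. ?m y * (2 * \<bar>H (x - y) - H x\<bar>))"
        by (rule nn_integral_eq_integral[OF intH]) (simp add: mollifier_nonneg)
      then show "ennreal ((conv G ?m x - G x)\<^sup>2) \<le> (\<integral>\<^sup>+y. ennreal (?m y * (2 * \<bar>H (x - y) - H x\<bar>)) \<partial>lborel)"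
        using pointwise[of x] by (simp add: ennreal_leI)
    qed
    also have "\<dots> = (\<integral>\<^sup>+y. \<integral>\<^sup>+x. ennreal (?m y * (2 * \<bar>H (x - y) - H x\<bar>)) \<partial>lborel \<partial>lborel)"
      by (rule lborel_pair.Fubini') measurable
    also have "\<dots> \<le> (\<integral>\<^sup>+y. ennreal (?m y * e) \<partial>lborel)"
    proof (rule nn_integral_mono)
      fix y
      have iH: "integrable lborel (\<lambda>x. \<bar>H (x - y) - H x\<bar>)"
        using H integrable_shift[OF H, of y] by simp
      have "(\<integral>\<^sup>+x. ennreal (?m y * (2 * \<bar>H (x - y) - H x\<bar>)) \<partial>lborel) =
          ennreal (LINT x|lborel. ?m y * (2 * \<bar>H (x - y) - H x\<bar>))"
        by (rule nn_integral_eq_integral) (use iH in \<open>auto simp: mollifier_nonneg\<close>)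
      also have "(LINT x|lborel. ?m y * (2 * \<bar>H (x - y) - H x\<bar>)) = ?m y * (2 * shift_dist H y)"
        by simp
      also have "ennreal (?m y * (2 * shift_dist H y)) \<le> ennreal (?m y * e)"
      proof (rule ennreal_leI)
        show "?m y * (2 * shift_dist H y) \<le> ?m y * e"
        proof (cases "norm y < \<delta>")
          case True
          then have "2 * shift_dist H y \<le> e" using small[of y] \<delta> by simp
          then show ?thesis by (rule mult_left_mono[OF _ mollifier_nonneg])
        next
          case False
          then show ?thesis using mollifier_eq_0[OF \<delta>(1), of y] by simp
        qed
      qed
      finally show "(\<integral>\<^sup>+x. ennreal (?m y * (2 * \<bar>H (x - y) - H x\<bar>)) \<partial>lborel) \<le> ennreal (?m y * e)" .
    qed
    also have "\<dots> = ennreal (LINT y|lborel. ?m y * e)"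
      by (rule nn_integral_eq_integral) (use mi e in \<open>auto simp: mollifier_nonneg\<close>)
    also have "(LINT y|lborel. ?m y * e) = e"
      using mi mollifier_integral[OF \<delta>(1), where 'n='n] by simp
    finally have le: "(\<integral>\<^sup>+x. ennreal ((conv G ?m x - G x)\<^sup>2) \<partial>lborel) \<le> ennreal e" .
    then have int: "integrable lborel (\<lambda>x. (conv G ?m x - G x)\<^sup>2)"
      by (intro integrableI_nonneg) (auto intro: le_less_trans)
    have "ennreal (LINT x|lborel. (conv G ?m x - G x)\<^sup>2) \<le> ennreal e"
      using le nn_integral_eq_integral[OF int] by simp
    then have "(LINT x|lborel. (conv G ?m x - G x)\<^sup>2) \<le> e"
      using e by (simp add: ennreal_le_iff)
    note int this
  }
  then show ?thesis
    using d(1) that by blast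
qed

section \<open>Smooth approximation of functions with a weak gradient\<close>

lemma integral_lebesgue_on_eq:
  fixes f :: "'a::euclidean_space \<Rightarrow> 'b::euclidean_space"
  assumes "S \<in> sets lebesgue" "\<And>x. x \<notin> S \<Longrightarrow> f x = 0"
  shows "(LINT x|lebesgue_on S. f x) = (LINT x|lebesgue. f x)"
proof -
  have "(\<lambda>x. if x \<in> S then f x else 0) = f"
    using assms(2) by auto
  then show ?thesis
    using Lebesgue_Measure.integral_restrict_UNIV[OF assms(1), of f] by simp
qed

text \<open>Needed because the weak gradient is tested with \<open>y \<mapsto> mollifier \<delta> (x - y)\<close>.\<close>

lemma smooth_on_reflect:
  fixes \<rho> :: "real^'n \<Rightarrow> real"
  assumes "smooth_on UNIV \<rho>"
  shows "smooth_on UNIV (\<lambda>y. \<rho> (x - y))"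
    and "grad (\<lambda>y. \<rho> (x - y)) y $ i = - grad \<rho> (x - y) $ i"
proof -
  have D: "((\<lambda>y. c * \<rho> (x - y)) has_derivative (\<lambda>h. c * (grad \<rho> (x - y) \<bullet> (- h)))) (at y)"
    if "smooth_on UNIV \<rho>" for \<rho> :: "real^'n \<Rightarrow> real" and c y
  proof -
    have "((\<lambda>y. x - y) has_derivative (\<lambda>h. - h)) (at y)"
      by (auto intro!: derivative_eq_intros)
    moreover have "(\<rho> has_derivative (\<lambda>h. grad \<rho> (x - y) \<bullet> h)) (at (x - y))"
      by (rule has_derivative_grad) (use smooth_on_differentiable[OF that] in auto)
    ultimately have "((\<lambda>y. \<rho> (x - y)) has_derivative (\<lambda>h. grad \<rho> (x - y) \<bullet> (- h))) (at y)"
      using diff_chain_at[of "\<lambda>y. x - y" "\<lambda>h. - h" y \<rho> "\<lambda>h. grad \<rho> (x - y) \<bullet> h"]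
      unfolding o_def by blast
    then show ?thesis
      by (rule has_derivative_mult_right)
  qed
  have g: "grad (\<lambda>y. c * \<rho> (x - y)) y $ i = - c * grad \<rho> (x - y) $ i"
    if "smooth_on UNIV \<rho>" for \<rho> :: "real^'n \<Rightarrow> real" and c y i
    using grad_eq[OF D[OF that, of c y], of i] by (simp add: inner_axis)
  show "grad (\<lambda>y. \<rho> (x - y)) y $ i = - grad \<rho> (x - y) $ i"
    using g[OF assms, of 1 y i] by simp
  show "smooth_on UNIV (\<lambda>y. \<rho> (x - y))"
  proof (rule smooth_on_coinduct[where P="\<lambda>f. \<exists>\<rho> c. smooth_on UNIV \<rho> \<and> f = (\<lambda>y. c * \<rho> (x - y))"])
    show "\<exists>\<rho>' c. smooth_on UNIV \<rho>' \<and> (\<lambda>y. \<rho> (x - y)) = (\<lambda>y. c * \<rho>' (x - y))"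
      by (rule exI[of _ \<rho>], rule exI[of _ 1]) (use assms in simp)
  next
    fix f assume "\<exists>\<rho> c. smooth_on UNIV \<rho> \<and> f = (\<lambda>y. c * \<rho> (x - y))"
    then obtain \<rho> c where \<rho>: "smooth_on UNIV \<rho>" and f: "f = (\<lambda>y. c * \<rho> (x - y))" by blast
    have "f differentiable (at y)" for y
      using D[OF \<rho>] unfolding f differentiable_def by blast
    moreover have "smooth_on UNIV (\<lambda>x. grad \<rho> x $ i)"
        "(\<lambda>y. grad f y $ i) = (\<lambda>y. - c * grad \<rho> (x - y) $ i)" for i
      using smooth_on_partial[OF \<rho>] g[OF \<rho>] by (auto simp: f)
    ultimately show "(\<forall>x\<in>UNIV. f differentiable at x) \<and>
        (\<forall>i. \<exists>\<rho> c. smooth_on UNIV \<rho> \<and> (\<lambda>y. grad f y $ i) = (\<lambda>y. c * \<rho> (x - y)))"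
      by (metis (no_types, lifting))
  qed
qed

lemma has_weak_gradD:
  assumes "has_weak_grad \<Omega> v g" "\<phi> \<in> test_functions \<Omega>"
  shows "(LINT x|lebesgue_on \<Omega>. v x * grad \<phi> x $ i) = - (LINT x|lebesgue_on \<Omega>. g x $ i * \<phi> x)"
  using assms unfolding has_weak_grad_def by blast

lemma L2_on_component:
  fixes g :: "real^'n \<Rightarrow> real^'n"
  assumes "L2_on K g"
  shows "L2_on K (\<lambda>x. g x $ i)"
proof -
  have m: "(\<lambda>x. g x $ i) \<in> borel_measurable (lebesgue_on K)"
    using assms unfolding L2_on_def
    by (intro borel_measurable_continuous_on[of "\<lambda>x. x $ i" g]) (auto intro!: continuous_intros)
  have "integrable (lebesgue_on K) (\<lambda>x. (g x $ i)\<^sup>2)"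
  proof (rule Bochner_Integration.integrable_bound)
    show "integrable (lebesgue_on K) (\<lambda>x. (norm (g x))\<^sup>2)"
      using assms by (simp add: L2_on_def)
    show "AE x in lebesgue_on K. norm ((g x $ i)\<^sup>2) \<le> norm ((norm (g x))\<^sup>2)"
    proof (rule AE_I2)
      fix x
      have "\<bar>g x $ i\<bar>\<^sup>2 \<le> (norm (g x))\<^sup>2"
        by (rule power_mono[OF component_le_norm_cart]) simp
      then show "norm ((g x $ i)\<^sup>2) \<le> norm ((norm (g x))\<^sup>2)" by simp
    qed
  qed (use m in measurable)
  then show ?thesis
    using m by (simp add: L2_on_def)
qed

text \<open>Tonelli's theorem will be applied to \<open>G (x - y)\<close> as a function of the pair \<open>(x, y)\<close>. It is
  jointly measurable for a Borel function \<open>G\<close>, but Lebesgue measurability of \<open>G\<close> would not give this.\<close>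

lemma L2_on_borel_version:
  fixes f :: "real^'n \<Rightarrow> real"
  assumes f: "L2_on K f" and K: "compact K"
  obtains G where "G \<in> borel_measurable borel" "integrable lborel G" "integrable lborel (\<lambda>x. (G x)\<^sup>2)"
    "AE x in lebesgue. G x = (if x \<in> K then f x else 0)"
proof -
  have Kl: "K \<in> sets lebesgue" "K \<in> sets borel"
    using K by (auto simp: compact_imp_closed)
  let ?f = "\<lambda>x. if x \<in> K then f x else 0"
  have fm: "?f \<in> borel_measurable lebesgue"
    using f Kl by (simp add: borel_measurable_if L2_on_def)
  obtain G where G[measurable]: "G \<in> borel_measurable borel" and ae: "AE x in lborel. ?f x = G x"
    using completion_ex_borel_measurable_real[OF fm] by auto
  have ae': "AE x in lebesgue. G x = ?f x"
    using AE_completion[OF ae] by eventually_elim (rule sym)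
  have "integrable lebesgue (\<lambda>x. indicator K x *\<^sub>R (f x)\<^sup>2)"
    using f Kl by (simp add: L2_on_def integrable_restrict_space)
  moreover have "indicator K x *\<^sub>R (f x)\<^sup>2 = (?f x)\<^sup>2" for x
    by simp
  ultimately have "integrable lebesgue (\<lambda>x. (?f x)\<^sup>2)"
    by simp
  moreover have "AE x in lebesgue. (?f x)\<^sup>2 = (G x)\<^sup>2"
    using ae' by eventually_elim simp
  moreover have Gl: "G \<in> borel_measurable lebesgue"
    using G by (simp add: measurable_completion)
  ultimately have "integrable lebesgue (\<lambda>x. (G x)\<^sup>2)"
    by (intro integrable_cong_AE_imp[of lebesgue "\<lambda>x. (?f x)\<^sup>2" "\<lambda>x. (G x)\<^sup>2"] borel_measurable_power)
      (auto elim: eventually_mono)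
  then have G2: "integrable lborel (\<lambda>x. (G x)\<^sup>2)"
    by (simp add: integrable_completion)
  have iK: "integrable lborel (indicat_real K)"
    using emeasure_compact_finite[OF K] Kl by (intro integrable_real_indicator) auto
  have "integrable lborel G"
  proof (rule Bochner_Integration.integrable_bound)
    show "integrable lborel (\<lambda>x. indicat_real K x + (G x)\<^sup>2)"
      using iK G2 by simp
    show "AE x in lborel. norm (G x) \<le> norm (indicat_real K x + (G x)\<^sup>2)"
      using ae
    proof eventually_elim
      case (elim x)
      have "\<bar>G x\<bar> \<le> 1 + (G x)\<^sup>2"
        using sum_squares_ge_zero[of "\<bar>G x\<bar> - 1" 0] by (cases "\<bar>G x\<bar> \<le> 1")
          (auto simp: power2_eq_square algebra_simps intro: order_trans[OF _ self_le_power])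
      then show ?case using elim by (auto simp: indicator_def)
    qed
  qed measurable
  then show ?thesis
    using that[OF G _ G2 ae'] by blast
qed

text \<open>Testing the definition of the weak gradient with \<open>y \<mapsto> mollifier \<delta> (x - y)\<close> shows that the gradient
  of a mollification is the mollification of the weak gradient, at every point whose
  \<open>\<delta>\<close>-neighbourhood lies in \<open>U\<close>. The function that is mollified is \<open>Z\<close>, not \<open>z\<close>: it is continuous on the
  whole space, so that the convergence is uniform everywhere, and the two agree on \<open>U\<close>.\<close>

lemma smooth_approximation:
  fixes z Z :: "real^'n \<Rightarrow> real" and g :: "real^'n \<Rightarrow> real^'n"
  assumes \<Omega>: "\<Omega> \<in> sets lebesgue" and weak: "has_weak_grad \<Omega> z g" and g: "L2_loc \<Omega> g"
    and Z: "continuous_on UNIV Z" "compact C" "\<And>x. x \<notin> C \<Longrightarrow> Z x = 0"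
    and U: "open U" "U \<subseteq> \<Omega>" "\<And>x. x \<in> U \<Longrightarrow> Z x = z x"
    and K: "compact K" "K \<subseteq> U"
  shows "\<exists>\<zeta>. (\<forall>k. smooth_on UNIV (\<zeta> k)) \<and> uniform_limit UNIV \<zeta> Z sequentially \<and>
    (\<forall>i. (\<lambda>k. LINT x|lebesgue_on K. (grad (\<zeta> k) x $ i - g x $ i)\<^sup>2) \<longlonglongrightarrow> 0)"
proof -
  have Zi: "integrable lborel Z"
  proof -
    have "integrable lborel (\<lambda>x. indicator C x *\<^sub>R Z x)"
      using Z by (intro borel_integrable_compact) (auto intro: continuous_on_subset)
    moreover have "(\<lambda>x. indicator C x *\<^sub>R Z x) = Z"
      using Z(3) by (force simp: indicator_def)
    ultimately show ?thesis by simp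
  qed
  have [measurable]: "Z \<in> borel_measurable borel" using Zi by auto
  define \<delta> where "\<delta> k = inverse (real (Suc k))" for k
  have \<delta>: "0 < \<delta> k" for k by (simp add: \<delta>_def)
  have \<delta>_lim: "\<delta> \<longlonglongrightarrow> 0"
    unfolding \<delta>_def by (rule LIMSEQ_inverse_real_of_nat)
  define \<zeta> where "\<zeta> k = conv Z (mollifier (\<delta> k))" for k
  have smooth: "smooth_on UNIV (\<zeta> k)" for k
    unfolding \<zeta>_def by (rule smooth_on_conv[OF Zi mollifier_test_function])
  have unif: "uniform_limit UNIV \<zeta> Z sequentially"
  proof (rule uniform_limitI)
    fix e :: real assume e: "0 < e"
    obtain B where B: "\<And>x. x \<in> C \<Longrightarrow> norm x \<le> B"
      using compact_imp_bounded[OF Z(2)] by (auto simp: bounded_iff)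
    have "uniformly_continuous_on (cball 0 (B + 2)) Z"
      using Z(1) by (intro compact_uniformly_continuous) (auto intro: continuous_on_subset)
    then obtain d where d: "0 < d" "\<And>x y. x \<in> cball 0 (B + 2) \<Longrightarrow> y \<in> cball 0 (B + 2) \<Longrightarrow>
        dist y x < d \<Longrightarrow> dist (Z y) (Z x) < e / 2"
      using e unfolding uniformly_continuous_on_def by (metis half_gt_zero)
    have close: "\<bar>Z (x - y) - Z x\<bar> \<le> e / 2" if y: "norm y < min d 1" for x y
    proof (cases "norm x \<le> B + 1")
      case True
      have "norm (x - y) \<le> norm x + norm y" by (rule norm_triangle_ineq4)
      then have "x \<in> cball 0 (B + 2)" "x - y \<in> cball 0 (B + 2)"
        using True y by auto
      from d(2)[OF this] y show ?thesis by (simp add: dist_norm)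
    next
      case False
      have "norm x - norm y \<le> norm (x - y)" by (rule norm_triangle_ineq2)
      then have "x \<notin> C" "x - y \<notin> C" using B[of x] B[of "x - y"] False y by auto
      then show ?thesis using Z(3) e by simp
    qed
    have "eventually (\<lambda>k. \<delta> k < min d 1) sequentially"
      using d(1) by (intro order_tendstoD(2)[OF \<delta>_lim]) simp
    then show "\<forall>\<^sub>F k in sequentially. \<forall>x\<in>UNIV. dist (\<zeta> k x) (Z x) < e"
    proof eventually_elim
      case (elim k)
      have "\<bar>\<zeta> k x - Z x\<bar> \<le> e / 2" for x
        unfolding \<zeta>_def using elim by (intro conv_mollifier_approx[OF Zi \<delta>] close) auto
      moreover have "e / 2 < e" using e by simp
      ultimately have "dist (\<zeta> k x) (Z x) < e" for x
        unfolding dist_real_def by (rule le_less_trans)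
      then show ?case by blast
    qed
  qed
  have L2: "(\<lambda>k. LINT x|lebesgue_on K. (grad (\<zeta> k) x $ i - g x $ i)\<^sup>2) \<longlonglongrightarrow> 0" for i
  proof -
    obtain r where r: "0 < r" "(\<Union>x\<in>K. cball x r) \<subseteq> U"
      using compact_subset_open_imp_cball_epsilon_subset[OF K(1) U(1) K(2)] by metis
    \<comment> \<open>All values of \<open>g\<close> that enter the mollifications at points of \<open>K\<close> are values on this larger compact set,
      so \<open>g\<close> may be cut off outside it.\<close>
    define K' where "K' = (\<Union>x\<in>K. cball x r)"
    have K': "compact K'" "K' \<subseteq> U" "K' \<subseteq> \<Omega>"
      using compact_minkowski_sum_cball[OF K(1)] r(2) U(2) by (auto simp: K'_def)
    have KK': "K \<subseteq> K'"
      using r(1) by (force simp: K'_def)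
    have "L2_on K' (\<lambda>x. g x $ i)"
      using g K' by (intro L2_on_component) (simp add: L2_loc_def)
    then obtain G where G[measurable]: "G \<in> borel_measurable borel"
      and Gi: "integrable lborel G" and G2: "integrable lborel (\<lambda>x. (G x)\<^sup>2)"
      and Gg: "AE x in lebesgue. G x = (if x \<in> K' then g x $ i else 0)"
      using L2_on_borel_version[OF _ K'(1)] by blast
    have Gl: "G \<in> borel_measurable lebesgue"
      using G by (simp add: measurable_completion)
    have grad_\<zeta>: "grad (\<zeta> k) x $ i = conv G (mollifier (\<delta> k)) x" if x: "x \<in> K" and k: "\<delta> k \<le> r" for x k
    proof -
      let ?m = "mollifier (\<delta> k) :: real^'n \<Rightarrow> real"
      have m: "?m \<in> test_functions UNIV" by (rule mollifier_test_function)
      have [measurable]: "?m \<in> borel_measurable borel"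
        "(\<lambda>x. grad ?m x $ i) \<in> borel_measurable borel"
        using test_functions_integrable(2)[OF m]
          test_functions_integrable(2)[OF test_functions_partial[OF m]] by auto
      define \<psi> where "\<psi> y = ?m (x - y)" for y
      have \<psi>0: "\<psi> y = 0" if "y \<notin> cball x (\<delta> k)" for y
        using that mollifier_eq_0[OF \<delta>, of k "x - y"] by (simp add: \<psi>_def dist_norm)
      have ball: "cball x (\<delta> k) \<subseteq> K'"
        using x k by (force simp: K'_def)
      have \<psi>: "\<psi> \<in> test_functions (cball x (\<delta> k))"
        by (rule test_functionsI[of _ "cball x (\<delta> k)"])
          (use \<psi>0 smooth_on_reflect(1)[OF test_functions_smooth[OF m]] in \<open>auto simp: \<psi>_def[abs_def]\<close>)
      have g\<psi>: "grad \<psi> y $ j = - grad ?m (x - y) $ j" for y j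
        unfolding \<psi>_def[abs_def] by (rule smooth_on_reflect(2)[OF test_functions_smooth[OF m]])
      have g\<psi>0: "grad \<psi> y $ i = 0" if "y \<notin> cball x (\<delta> k)" for y
        using test_functionsE[OF \<psi>] that by (metis subset_iff zero_index)
      have "grad (\<zeta> k) x $ i = (LINT y|lborel. Z y * grad ?m (x - y) $ i)"
        unfolding \<zeta>_def grad_conv[OF Zi m] by (simp add: conv_def)
      also have "\<dots> = (LINT y|lebesgue. Z y * grad ?m (x - y) $ i)"
        by (rule integral_completion[symmetric]) measurable
      also have "\<dots> = - (LINT y|lebesgue. Z y * grad \<psi> y $ i)"
        by (simp add: g\<psi>)
      also have "(LINT y|lebesgue. Z y * grad \<psi> y $ i) = (LINT y|lebesgue. z y * grad \<psi> y $ i)"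
      proof (rule Bochner_Integration.integral_cong)
        fix y
        show "Z y * grad \<psi> y $ i = z y * grad \<psi> y $ i"
        proof (cases "y \<in> cball x (\<delta> k)")
          case True
          then have "y \<in> U" using ball K'(2) by blast
          then show ?thesis using U(3) by simp
        qed (simp add: g\<psi>0)
      qed simp
      also have "\<dots> = (LINT y|lebesgue_on \<Omega>. z y * grad \<psi> y $ i)"
        using g\<psi>0 ball K'(3) by (intro integral_lebesgue_on_eq[symmetric] \<Omega>) force
      also have "\<dots> = - (LINT y|lebesgue_on \<Omega>. g y $ i * \<psi> y)"
        using ball K'(3) by (intro has_weak_gradD[OF weak] test_functions_mono[OF \<psi>]) auto
      also have "(LINT y|lebesgue_on \<Omega>. g y $ i * \<psi> y) = (LINT y|lebesgue. g y $ i * \<psi> y)"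
        using \<psi>0 ball K'(3) by (intro integral_lebesgue_on_eq \<Omega>) force
      also have "\<dots> = (LINT y|lebesgue. (if y \<in> K' then g y $ i else 0) * \<psi> y)"
      proof (rule Bochner_Integration.integral_cong)
        fix y
        have "\<psi> y = 0" if "y \<notin> K'"
          using that ball \<psi>0 by blast
        then show "g y $ i * \<psi> y = (if y \<in> K' then g y $ i else 0) * \<psi> y"
          by simp
      qed simp
      also have "\<dots> = (LINT y|lebesgue. G y * \<psi> y)"
      proof (rule Bochner_Integration.integral_cong_AE)
        have "\<psi> \<in> borel_measurable borel"
          by (rule test_functions_integrable(2)[OF \<psi>])
        then have \<psi>l: "\<psi> \<in> borel_measurable lebesgue" by (simp add: measurable_completion)
        then show "(\<lambda>y. G y * \<psi> y) \<in> borel_measurable lebesgue" using Gl by simp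
        have "(\<lambda>y. if y \<in> K' then g y $ i else 0) \<in> borel_measurable lebesgue"
          using \<open>L2_on K' (\<lambda>x. g x $ i)\<close> K'(1)
          by (intro borel_measurable_if[THEN iffD2]) (auto simp: L2_on_def compact_imp_closed)
        then show "(\<lambda>y. (if y \<in> K' then g y $ i else 0) * \<psi> y) \<in> borel_measurable lebesgue"
          using \<psi>l by simp
        show "AE y in lebesgue. (if y \<in> K' then g y $ i else 0) * \<psi> y = G y * \<psi> y"
          using Gg by eventually_elim simp
      qed
      also have "\<dots> = (LINT y|lborel. G y * \<psi> y)"
        by (rule integral_completion) (use G test_functions_integrable(2)[OF \<psi>] in measurable)
      finally show ?thesis
        by (simp add: conv_def \<psi>_def)
    qed
    show ?thesis
    proof (rule order_tendstoI)
      fix a :: real assume "a < 0"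
      then show "\<forall>\<^sub>F k in sequentially. a < (LINT x|lebesgue_on K. (grad (\<zeta> k) x $ i - g x $ i)\<^sup>2)"
        by (intro always_eventually allI less_le_trans[OF _ integral_nonneg_AE]) auto
    next
      fix a :: real assume a: "0 < a"
      then have a2: "0 < a / 2" by simp
      obtain d where d: "0 < d"
        "\<And>\<delta>. 0 < \<delta> \<Longrightarrow> \<delta> < d \<Longrightarrow> integrable lborel (\<lambda>x. (conv G (mollifier \<delta>) x - G x)\<^sup>2)"
        "\<And>\<delta>. 0 < \<delta> \<Longrightarrow> \<delta> < d \<Longrightarrow> (LINT x|lborel. (conv G (mollifier \<delta>) x - G x)\<^sup>2) \<le> a / 2"
        by (rule mollification_L2[OF Gi G2 a2]) blast
      have "eventually (\<lambda>k. \<delta> k < min d r) sequentially"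
        using d(1) r(1) by (intro order_tendstoD(2)[OF \<delta>_lim]) simp
      then show "\<forall>\<^sub>F k in sequentially. (LINT x|lebesgue_on K. (grad (\<zeta> k) x $ i - g x $ i)\<^sup>2) < a"
      proof eventually_elim
        case (elim k)
        let ?c = "conv G (mollifier (\<delta> k)) :: real^'n \<Rightarrow> real"
        have cm: "?c \<in> borel_measurable borel"
          by (intro borel_measurable_continuous_onI smooth_on_continuous
              smooth_on_conv[OF Gi mollifier_test_function])
        have int: "integrable lebesgue (\<lambda>x. (?c x - G x)\<^sup>2)"
          using d(2)[of "\<delta> k"] elim \<delta>[of k] cm G by (simp add: integrable_completion)
        have Kl: "K \<in> sets lebesgue" using K(1) by (simp add: compact_imp_closed)
        have gK: "(\<lambda>x. g x $ i) \<in> borel_measurable (lebesgue_on K)"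
          using L2_on_component[of K g i] g K U by (auto simp: L2_loc_def L2_on_def)
        have dm: "(\<lambda>x. grad (\<zeta> k) x $ i) \<in> borel_measurable (lebesgue_on K)"
          using smooth_on_continuous[OF smooth_on_partial[OF smooth[of k], of i]]
          by (intro continuous_imp_measurable_on_sets_lebesgue Kl) (auto intro: continuous_on_subset)
        have "(LINT x|lebesgue_on K. (grad (\<zeta> k) x $ i - g x $ i)\<^sup>2) =
            (LINT x|lebesgue_on K. (?c x - G x)\<^sup>2)"
        proof (rule Bochner_Integration.integral_cong_AE)
          show "(\<lambda>x. (grad (\<zeta> k) x $ i - g x $ i)\<^sup>2) \<in> borel_measurable (lebesgue_on K)"
            using gK dm by measurable
          show "(\<lambda>x. (?c x - G x)\<^sup>2) \<in> borel_measurable (lebesgue_on K)"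
            using int by (intro measurable_restrict_space1) auto
          show "AE x in lebesgue_on K. (grad (\<zeta> k) x $ i - g x $ i)\<^sup>2 = (?c x - G x)\<^sup>2"
            using Kl Gg KK' grad_\<zeta>[of _ k] elim
            by (auto simp: AE_restrict_space_iff elim!: eventually_mono)
        qed
        also have "\<dots> \<le> (LINT x|lebesgue. (?c x - G x)\<^sup>2)"
          unfolding Lebesgue_Measure.integral_restrict_UNIV[OF Kl, symmetric]
          by (rule Bochner_Integration.integral_mono')
            (use int in auto)
        also have "\<dots> = (LINT x|lborel. (?c x - G x)\<^sup>2)"
          by (rule integral_completion) (use cm G in measurable)
        also have "\<dots> \<le> a / 2"
          using d(3)[of "\<delta> k"] elim \<delta>[of k] by simp
        also have "\<dots> < a" using a by simp
        finally show ?case .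
      qed
    qed
  qed
  show ?thesis
    using smooth unif L2 by blast
qed

lemma integrable_mult_L2:
  fixes a b :: "'a \<Rightarrow> real"
  assumes [measurable]: "a \<in> borel_measurable M" "b \<in> borel_measurable M"
    and "integrable M (\<lambda>x. (a x)\<^sup>2)" "integrable M (\<lambda>x. (b x)\<^sup>2)"
  shows "integrable M (\<lambda>x. a x * b x)"
proof (rule Bochner_Integration.integrable_bound)
  show "integrable M (\<lambda>x. (a x)\<^sup>2 + (b x)\<^sup>2)" using assms by simp
  have "\<bar>p * q\<bar> \<le> p\<^sup>2 + q\<^sup>2" for p q :: real
  proof -
    have "2 * (\<bar>p\<bar> * \<bar>q\<bar>) \<le> p\<^sup>2 + q\<^sup>2"
      using sum_squares_bound[of "\<bar>p\<bar>" "\<bar>q\<bar>"] by simp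
    moreover have "0 \<le> \<bar>p\<bar> * \<bar>q\<bar>" by simp
    ultimately show ?thesis unfolding abs_mult by linarith
  qed
  then show "AE x in M. norm (a x * b x) \<le> norm ((a x)\<^sup>2 + (b x)\<^sup>2)"
    by simp
qed measurable

text \<open>The product of an \<open>L\<^sup>2\<close> function with an \<open>L\<^sup>2\<close> convergent sequence may be integrated termwise, even
  with additional bounded weights that converge only pointwise: the weights are handled by
  dominated convergence, the remaining error by Young's inequality with a weight that depends on \<open>k\<close>.\<close>

lemma tendsto_integral_mult_L2:
  fixes b f :: "'a \<Rightarrow> real" and c F :: "nat \<Rightarrow> 'a \<Rightarrow> real"
  assumes m[measurable]: "b \<in> borel_measurable M" "f \<in> borel_measurable M" "\<And>k. F k \<in> borel_measurable M"
      "\<And>k. c k \<in> borel_measurable M" "c' \<in> borel_measurable M"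
    and L2: "integrable M (\<lambda>x. (b x)\<^sup>2)" "integrable M (\<lambda>x. (f x)\<^sup>2)"
      "\<And>k. integrable M (\<lambda>x. (F k x - f x)\<^sup>2)"
    and lim: "(\<lambda>k. LINT x|M. (F k x - f x)\<^sup>2) \<longlonglongrightarrow> 0"
    and c: "\<And>k x. \<bar>c k x\<bar> \<le> C" "\<And>x. (\<lambda>k. c k x) \<longlonglongrightarrow> c' x"
  shows "(\<lambda>k. LINT x|M. c k x * b x * F k x) \<longlonglongrightarrow> (LINT x|M. c' x * b x * f x)"
    and "integrable M (\<lambda>x. c k x * b x * F k x)"
proof -
  have C: "0 \<le> C" using c(1) by (meson abs_ge_zero order_trans)
  have bounded_mult: "integrable M (\<lambda>x. c k x * b x * h x)"
    if [measurable]: "h \<in> borel_measurable M" and "integrable M (\<lambda>x. (h x)\<^sup>2)" for h k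
  proof (rule Bochner_Integration.integrable_bound)
    show "integrable M (\<lambda>x. C * (b x * h x))"
      using integrable_mult_L2[OF m(1) that(1) L2(1) that(2)] by simp
    show "AE x in M. norm (c k x * b x * h x) \<le> norm (C * (b x * h x))"
      using c(1) C by (auto simp: abs_mult mult.assoc intro!: mult_right_mono)
  qed measurable
  have i1: "integrable M (\<lambda>x. c k x * b x * f x)" for k
    using bounded_mult L2 by simp
  have i2: "integrable M (\<lambda>x. c k x * b x * (F k x - f x))" for k
    using bounded_mult[of "\<lambda>x. F k x - f x"] L2 by simp
  show "integrable M (\<lambda>x. c k x * b x * F k x)"
    using Bochner_Integration.integrable_add[OF i1[of k] i2[of k]] by (simp add: algebra_simps)
  have split: "(LINT x|M. c k x * b x * F k x) =
      (LINT x|M. c k x * b x * f x) + (LINT x|M. c k x * b x * (F k x - f x))" for k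
    using Bochner_Integration.integral_add[OF i1[of k] i2[of k]] by (simp add: algebra_simps)
  have lim1: "(\<lambda>k. LINT x|M. c k x * b x * f x) \<longlonglongrightarrow> (LINT x|M. c' x * b x * f x)"
  proof (rule integral_dominated_convergence[where w="\<lambda>x. C * \<bar>b x * f x\<bar>"])
    show "integrable M (\<lambda>x. C * \<bar>b x * f x\<bar>)"
      using integrable_mult_L2[OF m(1,2) L2(1,2)] by simp
    show "AE x in M. (\<lambda>k. c k x * b x * f x) \<longlonglongrightarrow> c' x * b x * f x"
      using c(2) by (intro AE_I2 tendsto_intros)
    show "AE x in M. norm (c k x * b x * f x) \<le> C * \<bar>b x * f x\<bar>" for k
      using c(1) by (auto simp: abs_mult mult.assoc intro!: mult_right_mono)
  qed measurable
  define I where "I k = (LINT x|M. (F k x - f x)\<^sup>2)" for k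
  define J where "J = (LINT x|M. (b x)\<^sup>2)"
  have I: "0 \<le> I k" for k by (simp add: I_def)
  have "(\<lambda>k. LINT x|M. c k x * b x * (F k x - f x)) \<longlonglongrightarrow> 0"
  proof (rule Lim_null_comparison)
    \<comment> \<open>The weight in Young's inequality below: it tends to zero, but slowly enough that \<open>I k / t k\<close> tends
      to zero as well. The second summand keeps it positive when \<open>I k = 0\<close>.\<close>
    define t where "t k = sqrt (I k) + inverse (real (Suc k))" for k
    have t: "0 < t k" for k
      using I[of k] by (simp add: t_def add_nonneg_pos)
    show "\<forall>\<^sub>F k in sequentially. norm (LINT x|M. c k x * b x * (F k x - f x)) \<le> C * (t k * J + sqrt (I k))"
    proof (rule always_eventually, rule allI)
      fix k
      have young: "\<bar>p * q\<bar> \<le> t k * p\<^sup>2 + inverse (t k) * q\<^sup>2" for p q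
      proof -
        have "0 \<le> (t k * \<bar>p\<bar> - \<bar>q\<bar>)\<^sup>2" by simp
        then have "2 * t k * \<bar>p * q\<bar> \<le> t k * (t k * p\<^sup>2) + q\<^sup>2"
          by (simp add: power2_diff power_mult_distrib abs_mult power2_eq_square[of "t k"])
        moreover have "0 \<le> t k * \<bar>p * q\<bar>" using t[of k] by simp
        ultimately have "t k * \<bar>p * q\<bar> \<le> t k * (t k * p\<^sup>2) + q\<^sup>2" by linarith
        then have "t k * \<bar>p * q\<bar> \<le> t k * (t k * p\<^sup>2 + inverse (t k) * q\<^sup>2)"
          using t[of k] by (simp add: distrib_left mult.assoc[symmetric])
        then show ?thesis using t[of k] by (metis mult_le_cancel_left_pos)
      qed
      have "norm (LINT x|M. c k x * b x * (F k x - f x)) \<le>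
          (LINT x|M. C * (t k * (b x)\<^sup>2 + inverse (t k) * (F k x - f x)\<^sup>2))"
        unfolding real_norm_def
      proof (rule order_trans[OF integral_abs_bound Bochner_Integration.integral_mono])
        show "integrable M (\<lambda>x. \<bar>c k x * b x * (F k x - f x)\<bar>)" using i2 by simp
        show "integrable M (\<lambda>x. C * (t k * (b x)\<^sup>2 + inverse (t k) * (F k x - f x)\<^sup>2))"
          using L2 by simp
        show "\<bar>c k x * b x * (F k x - f x)\<bar> \<le> C * (t k * (b x)\<^sup>2 + inverse (t k) * (F k x - f x)\<^sup>2)" for x
        proof -
          have "\<bar>c k x * b x * (F k x - f x)\<bar> = \<bar>c k x\<bar> * \<bar>b x * (F k x - f x)\<bar>"
            by (simp add: abs_mult)
          also have "\<dots> \<le> C * (t k * (b x)\<^sup>2 + inverse (t k) * (F k x - f x)\<^sup>2)"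
            by (rule mult_mono[OF c(1) young C]) simp
          finally show ?thesis .
        qed
      qed
      also have "\<dots> = C * (t k * J + inverse (t k) * I k)"
        using L2 by (simp add: I_def J_def)
      also have "inverse (t k) * I k \<le> sqrt (I k)"
      proof -
        have "I k = sqrt (I k) * sqrt (I k)" using I[of k] by simp
        also have "\<dots> \<le> sqrt (I k) * t k"
          using I[of k] by (intro mult_left_mono) (auto simp: t_def)
        finally show ?thesis using t[of k] by (simp add: field_simps)
      qed
      finally show "norm (LINT x|M. c k x * b x * (F k x - f x)) \<le> C * (t k * J + sqrt (I k))"
        using C by (simp add: mult_left_mono)
    qed
    have "I \<longlonglongrightarrow> 0" using lim by (simp add: I_def[abs_def])
    then have s: "(\<lambda>k. sqrt (I k)) \<longlonglongrightarrow> 0"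
      using tendsto_real_sqrt by fastforce
    have "t \<longlonglongrightarrow> 0 + 0"
      unfolding t_def by (intro tendsto_add s LIMSEQ_inverse_real_of_nat)
    then have "(\<lambda>k. C * (t k * J + sqrt (I k))) \<longlonglongrightarrow> C * ((0 + 0) * J + 0)"
      using s by (intro tendsto_intros)
    then show "(\<lambda>k. C * (t k * J + sqrt (I k))) \<longlonglongrightarrow> 0" by simp
  qed
  with lim1 have "(\<lambda>k. (LINT x|M. c k x * b x * f x) + (LINT x|M. c k x * b x * (F k x - f x)))
      \<longlonglongrightarrow> (LINT x|M. c' x * b x * f x) + 0"
    by (rule tendsto_add)
  then show "(\<lambda>k. LINT x|M. c k x * b x * F k x) \<longlonglongrightarrow> (LINT x|M. c' x * b x * f x)"
    by (simp add: split)
qed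

section \<open>The weak maximum principle\<close>

lemma flat_exp_bounded_above:
  obtains C where "0 \<le> C" "\<And>t. t \<le> T \<Longrightarrow> flat_exp n t \<le> C"
proof -
  have "compact (flat_exp n ` {0..T})"
    by (intro compact_continuous_image continuous_on_subset[OF flat_exp_continuous]) auto
  then obtain C where C: "\<And>t. t \<in> {0..T} \<Longrightarrow> \<bar>flat_exp n t\<bar> \<le> C"
    using compact_imp_bounded by (force simp: bounded_iff)
  have "flat_exp n t \<le> max C 0" if "t \<le> T" for t
    using C[of t] that by (cases "0 \<le> t") auto
  then show ?thesis using that[of "max C 0"] by simp
qed

lemma continuous_measurable_lebesgue_on:
  fixes f :: "'a::euclidean_space \<Rightarrow> real"
  assumes "continuous_on UNIV f" "K \<in> sets lebesgue"
  shows "f \<in> borel_measurable (lebesgue_on K)"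
  by (rule continuous_imp_measurable_on_sets_lebesgue[OF continuous_on_subset[OF assms(1)] assms(2)]) simp

lemma L2_on_continuous:
  fixes f :: "real^'n \<Rightarrow> real"
  assumes f: "continuous_on K f" and K: "compact K"
  shows "L2_on K f"
proof -
  have Kl: "K \<in> sets lebesgue" using K by (auto simp: compact_imp_closed)
  have "continuous_on K (\<lambda>x. (f x)\<^sup>2)"
    using f by (intro continuous_intros)
  then have *: "integrable lborel (\<lambda>x. indicator K x *\<^sub>R (f x)\<^sup>2)"
    by (rule borel_integrable_compact[OF K])
  then have "integrable lebesgue (\<lambda>x. indicator K x *\<^sub>R (f x)\<^sup>2)"
    by (subst integrable_completion) auto
  then have "integrable (lebesgue_on K) (\<lambda>x. (f x)\<^sup>2)"
    using Kl by (simp add: integrable_restrict_space)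
  then show ?thesis
    using continuous_imp_measurable_on_sets_lebesgue[OF f Kl] by (simp add: L2_on_def)
qed

lemma L2_onD:
  fixes f :: "real^'n \<Rightarrow> real"
  assumes "L2_on K f"
  shows "f \<in> borel_measurable (lebesgue_on K)" "integrable (lebesgue_on K) (\<lambda>x. (f x)\<^sup>2)"
  using assms by (auto simp: L2_on_def)

lemma L2_on_diff:
  fixes a b :: "real^'n \<Rightarrow> real"
  assumes "L2_on K a" "L2_on K b"
  shows "L2_on K (\<lambda>x. a x - b x)"
proof -
  note a = L2_onD[OF assms(1)] and b = L2_onD[OF assms(2)]
  have "integrable (lebesgue_on K) (\<lambda>x. (a x)\<^sup>2 + (b x)\<^sup>2 - 2 * (a x * b x))"
    using a b integrable_mult_L2[OF a(1) b(1) a(2) b(2)] by simp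
  then show ?thesis
    using a b by (simp add: L2_on_def power2_diff mult.assoc)
qed

text \<open>The flux \<open>B\<close> is abstract, tied to the weak gradient \<open>g\<close> by the coercivity
  \<open>B \<bullet> g \<ge> \<alpha> * (norm g)\<^sup>2\<close> alone, and the differential inequality is required only for test functions
  that live where \<open>z\<close> is positive. In this form terms of lower order can be discarded beforehand
  whenever they have the right sign there.\<close>

lemma weak_maximum_principle:
  fixes z :: "real^'n \<Rightarrow> real" and g B :: "real^'n \<Rightarrow> real^'n"
  assumes \<Omega>: "open \<Omega>" "bounded \<Omega>"
    and z: "continuous_on (closure \<Omega>) z" "\<And>x. x \<in> frontier \<Omega> \<Longrightarrow> z x \<le> 0"
    and weak: "has_weak_grad \<Omega> z g" and g: "L2_loc \<Omega> g" and B: "L2_loc \<Omega> B"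
    and coercive: "0 < \<alpha>" "AE x in lebesgue_on \<Omega>. \<alpha> * (norm (g x))\<^sup>2 \<le> B x \<bullet> g x"
    and sub: "\<And>\<phi>. \<phi> \<in> test_functions \<Omega> \<Longrightarrow> (\<And>x. 0 \<le> \<phi> x) \<Longrightarrow> (\<And>x. \<phi> x \<noteq> 0 \<Longrightarrow> 0 < z x) \<Longrightarrow>
      (LINT x|lebesgue_on \<Omega>. B x \<bullet> grad \<phi> x) \<le> 0"
    and x: "x \<in> \<Omega>"
  shows "z x \<le> 0"
proof -
  define Z where "Z x = (if x \<in> \<Omega> then max (z x) 0 else 0)" for x
  have cc: "compact (closure \<Omega>)"
    using \<Omega>(2) by simp
  \<comment> \<open>The positive part of a function that is nonpositive on the boundary extends by zero.\<close>
  have Z_cont: "continuous_on UNIV Z"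
  proof -
    have "continuous_on (closure \<Omega> \<union> - \<Omega>) Z"
      unfolding Z_def[abs_def]
    proof (rule continuous_on_cases)
      show "continuous_on (closure \<Omega>) (\<lambda>x. max (z x) 0)"
        using z(1) by (intro continuous_intros)
      show "\<forall>x. x \<in> closure \<Omega> \<and> x \<notin> \<Omega> \<or> x \<in> - \<Omega> \<and> x \<in> \<Omega> \<longrightarrow> max (z x) 0 = 0"
        using z(2) \<Omega>(1) by (auto simp: frontier_def interior_open max_def)
    qed (use \<Omega>(1) in \<open>auto simp: closed_Compl\<close>)
    moreover have "closure \<Omega> \<union> - \<Omega> = UNIV"
      using closure_subset[of \<Omega>] by blast
    ultimately show ?thesis by simp
  qed
  have Z0: "Z x = 0" if "x \<notin> closure \<Omega>" for x
    using that closure_subset[of \<Omega>] by (auto simp: Z_def)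
  have Z_nonneg: "0 \<le> Z x" for x
    by (simp add: Z_def)
  define U where "U = {x. 0 < Z x}"
  have U: "open U" "U \<subseteq> \<Omega>" "\<And>x. x \<in> U \<Longrightarrow> Z x = z x"
  proof -
    show "open U"
      unfolding U_def by (rule open_Collect_less) (use Z_cont in auto)
    show "U \<subseteq> \<Omega>" by (auto simp: U_def Z_def split: if_splits)
    show "Z x = z x" if "x \<in> U" for x
      using that by (auto simp: U_def Z_def max_def split: if_splits)
  qed
  have \<Omega>l: "\<Omega> \<in> sets lebesgue" using \<Omega>(1) by simp
  obtain T where T: "\<And>x. Z x \<le> T"
  proof -
    have "bounded (Z ` closure \<Omega>)"
      using cc Z_cont by (intro compact_imp_bounded compact_continuous_image) (auto intro: continuous_on_subset)
    then obtain T where "\<And>x. x \<in> closure \<Omega> \<Longrightarrow> \<bar>Z x\<bar> \<le> T"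
      by (auto simp: bounded_iff)
    then have "Z x \<le> max T 0" for x
      using Z0[of x] by (cases "x \<in> closure \<Omega>") force+
    then show ?thesis using that by blast
  qed
  have le_eps: "Z y \<le> \<epsilon>" if \<epsilon>: "0 < \<epsilon>" for \<epsilon> y
  proof -
    define K where "K = {x. \<epsilon> / 2 \<le> Z x}"
    have KU: "K \<subseteq> U" using \<epsilon> by (auto simp: K_def U_def)
    have K: "compact K"
    proof -
      have "closed K"
        unfolding K_def by (rule closed_Collect_le) (use Z_cont in auto)
      moreover have "bounded K"
        using KU U(2) \<Omega>(2) bounded_subset by blast
      ultimately show ?thesis by (simp add: compact_eq_bounded_closed)
    qed
    have K\<Omega>: "K \<subseteq> \<Omega>" using KU U(2) by blast
    have Kl: "K \<in> sets lebesgue" "K \<in> sets borel" using K by (auto simp: compact_imp_closed)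
    obtain \<zeta> where "(\<forall>k. smooth_on UNIV (\<zeta> k)) \<and> uniform_limit UNIV \<zeta> Z sequentially \<and>
      (\<forall>i. (\<lambda>k. LINT x|lebesgue_on K. (grad (\<zeta> k) x $ i - g x $ i)\<^sup>2) \<longlonglongrightarrow> 0)"
      using smooth_approximation[OF \<Omega>l weak g Z_cont cc Z0 U K KU] ..
    then have \<zeta>: "\<And>k. smooth_on UNIV (\<zeta> k)" "uniform_limit UNIV \<zeta> Z sequentially"
      "\<And>i. (\<lambda>k. LINT x|lebesgue_on K. (grad (\<zeta> k) x $ i - g x $ i)\<^sup>2) \<longlonglongrightarrow> 0"
      by blast+
    have "\<forall>\<^sub>F k in sequentially. \<forall>x\<in>UNIV. dist (\<zeta> k x) (Z x) < \<epsilon> / 2"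
      using \<epsilon> by (intro uniform_limitD[OF \<zeta>(2)]) simp
    then obtain N where N: "\<And>k x. N \<le> k \<Longrightarrow> \<bar>\<zeta> k x - Z x\<bar> < \<epsilon> / 2"
      by (auto simp: eventually_sequentially dist_real_def)
    \<comment> \<open>Dropping the first \<open>N\<close> members makes \<open>\<xi> k < \<epsilon>\<close> outside \<open>K\<close>, so \<open>flat_exp\<close> cuts everything off there.\<close>
    define \<xi> where "\<xi> k = \<zeta> (k + N)" for k
    have \<xi>: "smooth_on UNIV (\<xi> k)" "\<bar>\<xi> k x - Z x\<bar> < \<epsilon> / 2" for k x
      using \<zeta>(1) N[of "k + N"] by (auto simp: \<xi>_def)
    have \<xi>_lim: "(\<lambda>k. \<xi> k x) \<longlonglongrightarrow> Z x" for x
      unfolding \<xi>_def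
      by (rule LIMSEQ_ignore_initial_segment) (rule tendsto_uniform_limitI[OF \<zeta>(2)], simp)
    have \<xi>_grad: "(\<lambda>k. LINT x|lebesgue_on K. (grad (\<xi> k) x $ i - g x $ i)\<^sup>2) \<longlonglongrightarrow> 0" for i
      unfolding \<xi>_def by (rule LIMSEQ_ignore_initial_segment[OF \<zeta>(3)])
    \<comment> \<open>The test functions; \<open>c k\<close> is the factor from the chain rule, as \<open>flat_exp 2\<close> is the derivative
      of \<open>flat_exp 0\<close>, and the primed functions are the limits.\<close>
    define \<phi> where "\<phi> k x = flat_exp 0 (\<xi> k x + (- \<epsilon>))" for k x
    define c where "c k x = flat_exp 2 (\<xi> k x + (- \<epsilon>))" for k x
    define c' where "c' x = flat_exp 2 (Z x + (- \<epsilon>))" for x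
    define \<phi>' where "\<phi>' x = flat_exp 0 (Z x + (- \<epsilon>))" for x
    have arg_neg: "\<xi> k x + (- \<epsilon>) \<le> 0" if "x \<notin> K" for k x
    proof -
      have "Z x < \<epsilon> / 2" using that by (simp add: K_def)
      then show ?thesis using \<xi>(2)[of k x] by linarith
    qed
    have \<phi>0: "\<phi> k x = 0" and c0: "c k x = 0" if "x \<notin> K" for k x
      using arg_neg[OF that] by (simp_all add: \<phi>_def c_def)
    have \<phi>'0: "\<phi>' x = 0" if "x \<notin> K" for x
      using that \<epsilon> by (simp add: K_def \<phi>'_def)
    have \<xi>_shift: "smooth_on UNIV (\<lambda>x. \<xi> k x + (- \<epsilon>))" for k
      by (rule smooth_term_smooth[OF smooth_term.add[OF smooth_term.base[OF \<xi>(1)] smooth_term.const]])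
    have \<phi>_smooth: "smooth_on UNIV (\<phi> k)" for k
      unfolding \<phi>_def[abs_def] by (rule smooth_on_flat_exp[OF \<xi>_shift])
    have \<phi>_test: "\<phi> k \<in> test_functions S" if "K \<subseteq> S" for k S
      by (rule test_functionsI[OF \<phi>_smooth K that \<phi>0])
    have \<phi>_grad: "grad (\<phi> k) x $ i = c k x * grad (\<xi> k) x $ i" for k x i
    proof -
      have "grad (\<lambda>x. \<xi> k x + (- \<epsilon>)) x $ i = grad (\<xi> k) x $ i"
        using grad_add[of "\<xi> k" x "\<lambda>_. - \<epsilon>" i] smooth_on_differentiable[OF \<xi>(1), of x k]
        by (simp add: grad_const)
      then show ?thesis
        using grad_flat_exp(1)[of "\<lambda>x. \<xi> k x + (- \<epsilon>)" x 0 i] smooth_on_differentiable[OF \<xi>_shift, of x k]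
        by (simp add: \<phi>_def[abs_def] c_def numeral_2_eq_2)
    qed
    have \<xi>_cont: "continuous_on UNIV (\<xi> k)" for k
      by (rule smooth_on_continuous[OF \<xi>(1)])
    have c_cont: "continuous_on UNIV (c k)" "continuous_on UNIV c'" "continuous_on UNIV \<phi>'" for k
      unfolding c_def[abs_def] c'_def[abs_def] \<phi>'_def[abs_def]
      using \<xi>_cont[of k] Z_cont
      by (auto intro!: continuous_on_compose2[OF flat_exp_continuous] continuous_intros)
    note cm = continuous_measurable_lebesgue_on[OF c_cont(1) Kl(1)]
      continuous_measurable_lebesgue_on[OF c_cont(2) Kl(1)]
    have c_lim: "(\<lambda>k. c k x) \<longlonglongrightarrow> c' x" "(\<lambda>k. \<phi> k x) \<longlonglongrightarrow> \<phi>' x" for x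
      unfolding c_def c'_def \<phi>_def \<phi>'_def
      by (intro continuous_on_tendsto_compose[OF flat_exp_continuous] tendsto_intros \<xi>_lim; simp)+
    have arg_le: "\<xi> k x + (- \<epsilon>) \<le> T" "Z x + (- \<epsilon>) \<le> T" for k x
      using \<xi>(2)[of k x] T[of x] \<epsilon> by (auto simp: abs_if split: if_splits)
    obtain C where C: "0 \<le> C" "\<And>t. t \<le> T \<Longrightarrow> flat_exp 2 t \<le> C"
      by (rule flat_exp_bounded_above) blast
    obtain C0 where C0: "0 \<le> C0" "\<And>t. t \<le> T \<Longrightarrow> flat_exp 0 t \<le> C0"
      by (rule flat_exp_bounded_above) blast
    have c_bound: "\<bar>c k x\<bar> \<le> C" "\<bar>c' x\<bar> \<le> C" for k x
      using C(2)[OF arg_le(1)] C(2)[OF arg_le(2)] by (auto simp: c_def c'_def)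
    have gK: "L2_on K (\<lambda>x. g x $ i)" and BK: "L2_on K (\<lambda>x. B x $ i)" for i
      using g B K K\<Omega> by (auto intro!: L2_on_component simp: L2_loc_def)
    have \<xi>K: "L2_on K (\<lambda>x. grad (\<xi> k) x $ i)" for k i
      by (intro L2_on_continuous[OF _ K] continuous_on_subset[OF smooth_on_continuous[OF smooth_on_partial[OF \<xi>(1)]]])
        simp
    have limits: "(\<lambda>k. LINT x|lebesgue_on K. c k x * b x * grad (\<xi> k) x $ i) \<longlonglongrightarrow>
          (LINT x|lebesgue_on K. c' x * b x * g x $ i)"
      and int_k: "integrable (lebesgue_on K) (\<lambda>x. c k x * b x * grad (\<xi> k) x $ i)"
      and int_lim: "integrable (lebesgue_on K) (\<lambda>x. c' x * b x * g x $ i)"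
      if b: "L2_on K b" for b i k
    proof -
      show "(\<lambda>k. LINT x|lebesgue_on K. c k x * b x * grad (\<xi> k) x $ i) \<longlonglongrightarrow>
          (LINT x|lebesgue_on K. c' x * b x * g x $ i)"
        and "integrable (lebesgue_on K) (\<lambda>x. c k x * b x * grad (\<xi> k) x $ i)"
        using tendsto_integral_mult_L2[OF L2_onD(1)[OF b] L2_onD(1)[OF gK] L2_onD(1)[OF \<xi>K] cm
            L2_onD(2)[OF b] L2_onD(2)[OF gK] L2_onD(2)[OF L2_on_diff[OF \<xi>K gK]] \<xi>_grad c_bound(1) c_lim(1)]
        by blast+
      show "integrable (lebesgue_on K) (\<lambda>x. c' x * b x * g x $ i)"
        by (rule tendsto_integral_mult_L2(2)[OF L2_onD(1)[OF b] L2_onD(1)[OF gK[of i]] L2_onD(1)[OF gK[of i]]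
            cm(2,2) L2_onD(2)[OF b] L2_onD(2)[OF gK[of i]] _ _ c_bound(2)]) auto
    qed
    have lim_le: "(\<Sum>i\<in>UNIV. LINT x|lebesgue_on K. c' x * B x $ i * g x $ i) \<le> 0"
    proof (rule LIMSEQ_le_const2)
      show "(\<lambda>k. \<Sum>i\<in>UNIV. LINT x|lebesgue_on K. c k x * B x $ i * grad (\<xi> k) x $ i) \<longlonglongrightarrow>
          (\<Sum>i\<in>UNIV. LINT x|lebesgue_on K. c' x * B x $ i * g x $ i)"
        by (intro tendsto_sum limits BK)
      have "(\<Sum>i\<in>UNIV. LINT x|lebesgue_on K. c k x * B x $ i * grad (\<xi> k) x $ i) \<le> 0" for k
      proof -
        have 1: "B x \<bullet> grad (\<phi> k) x = (\<Sum>i\<in>UNIV. c k x * B x $ i * grad (\<xi> k) x $ i)" for x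
          by (simp add: inner_vec_def \<phi>_grad mult_ac)
        have "(\<Sum>i\<in>UNIV. LINT x|lebesgue_on K. c k x * B x $ i * grad (\<xi> k) x $ i)
            = (LINT x|lebesgue_on K. B x \<bullet> grad (\<phi> k) x)"
          unfolding 1 by (rule Bochner_Integration.integral_sum[symmetric]) (rule int_k[OF BK])
        also have "\<dots> = (LINT x|lebesgue. B x \<bullet> grad (\<phi> k) x)"
          by (rule integral_lebesgue_on_eq[OF Kl(1)]) (simp add: 1 c0)
        also have "\<dots> = (LINT x|lebesgue_on \<Omega>. B x \<bullet> grad (\<phi> k) x)"
        proof (rule integral_lebesgue_on_eq[OF \<Omega>l, symmetric])
          fix x assume "x \<notin> \<Omega>"
          then have "x \<notin> K" using K\<Omega> by blast
          then show "B x \<bullet> grad (\<phi> k) x = 0" by (simp add: 1 c0)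
        qed
        also have "\<dots> \<le> 0"
        proof (rule sub[OF \<phi>_test[OF K\<Omega>]])
          show "0 \<le> \<phi> k x" for x by (simp add: \<phi>_def)
          show "0 < z x" if "\<phi> k x \<noteq> 0" for x
          proof -
            have "x \<in> U" using that \<phi>0[of x k] KU by blast
            then show ?thesis using U(3)[of x] by (simp add: U_def)
          qed
        qed
        finally show ?thesis .
      qed
      then show "\<exists>N. \<forall>k\<ge>N. (\<Sum>i\<in>UNIV. LINT x|lebesgue_on K. c k x * B x $ i * grad (\<xi> k) x $ i) \<le> 0"
        by blast
    qed
    have vanish: "AE x in lebesgue_on K. c' x * g x $ i = 0" for i
    proof -
      have 1: "c' x * (B x \<bullet> g x) = (\<Sum>i\<in>UNIV. c' x * B x $ i * g x $ i)" for x
        by (simp add: inner_vec_def sum_distrib_left mult_ac)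
      have int: "integrable (lebesgue_on K) (\<lambda>x. c' x * (B x \<bullet> g x))"
        unfolding 1 by (intro Bochner_Integration.integrable_sum int_lim BK)
      have le: "(LINT x|lebesgue_on K. c' x * (B x \<bullet> g x)) \<le> 0"
        using lim_le Bochner_Integration.integral_sum[of UNIV "lebesgue_on K" "\<lambda>i x. c' x * B x $ i * g x $ i"]
          int_lim[OF BK] by (simp add: 1)
      have "AE x in lebesgue_on K. \<alpha> * (norm (g x))\<^sup>2 \<le> B x \<bullet> g x"
        using coercive(2) K\<Omega> Kl \<Omega>l by (auto simp: AE_restrict_space_iff elim!: eventually_mono)
      then have ell: "AE x in lebesgue_on K. c' x * (\<alpha> * (norm (g x))\<^sup>2) \<le> c' x * (B x \<bullet> g x)"
        by eventually_elim (simp add: c'_def mult_left_mono)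
      then have nn: "AE x in lebesgue_on K. 0 \<le> c' x * (B x \<bullet> g x)"
      proof eventually_elim
        case (elim x)
        have "0 \<le> c' x * (\<alpha> * (norm (g x))\<^sup>2)" using coercive(1) by (simp add: c'_def)
        then show ?case using elim by simp
      qed
      have "(LINT x|lebesgue_on K. c' x * (B x \<bullet> g x)) = 0"
        using le integral_nonneg_AE[OF nn] by simp
      then have "AE x in lebesgue_on K. c' x * (B x \<bullet> g x) = 0"
        using integral_nonneg_eq_0_iff_AE[OF int nn] by simp
      then show ?thesis
        using ell
      proof eventually_elim
        case (elim x)
        then have "c' x * (\<alpha> * (norm (g x))\<^sup>2) \<le> 0" by linarith
        moreover have "0 \<le> c' x * (\<alpha> * (norm (g x))\<^sup>2)" using coercive(1) by (simp add: c'_def)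
        ultimately have "c' x * (\<alpha> * (norm (g x))\<^sup>2) = 0" by simp
        then show ?case using coercive(1) by auto
      qed
    qed
    \<comment> \<open>Any coordinate serves for the integration by parts.\<close>
    define i where "i = (undefined :: 'n)"
    have coordK: "L2_on K (\<lambda>x. x $ i)"
      by (rule L2_on_continuous[OF _ K]) (intro continuous_intros)
    have "(LINT x|lebesgue_on K. c' x * x $ i * g x $ i) = 0"
      by (rule integral_eq_zero_AE) (use vanish[of i] in \<open>auto elim: eventually_mono\<close>)
    then have lim0: "(\<lambda>k. LINT x|lebesgue_on K. c k x * x $ i * grad (\<xi> k) x $ i) \<longlonglongrightarrow> 0"
      using limits[OF coordK, of i] by simp
    have by_parts: "(LINT x|lborel. \<phi> k x) = - (LINT x|lebesgue_on K. c k x * x $ i * grad (\<xi> k) x $ i)" for k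
    proof -
      have \<phi>U: "\<phi> k \<in> test_functions UNIV" by (rule \<phi>_test) simp
      define \<psi> where "\<psi> x = x $ i * \<phi> k x" for x
      have \<psi>: "\<psi> \<in> test_functions UNIV"
      proof (rule test_functionsI[OF _ K])
        show "smooth_on UNIV \<psi>"
          unfolding \<psi>_def[abs_def]
          by (rule smooth_term_smooth[OF smooth_term.mult[OF smooth_term.coord smooth_term.base[OF \<phi>_smooth]]])
      qed (auto simp: \<psi>_def \<phi>0)
      have g\<psi>: "grad \<psi> x $ i = x $ i * grad (\<phi> k) x $ i + \<phi> k x" for x
        unfolding \<psi>_def[abs_def]
        using grad_mult[of "\<lambda>x. x $ i" x "\<phi> k" i] has_derivative_coord[of i x] smooth_on_differentiable[OF \<phi>_smooth]
        by (auto simp: grad_coord differentiable_def)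
      have i\<psi>: "integrable lborel (\<lambda>x. grad \<psi> x $ i)"
        by (rule test_functions_integrable(1)[OF test_functions_partial[OF \<psi>]])
      have i\<phi>: "integrable lborel (\<phi> k)"
        by (rule test_functions_integrable(1)[OF \<phi>U])
      have eq: "x $ i * grad (\<phi> k) x $ i = grad \<psi> x $ i - \<phi> k x" for x
        by (simp add: g\<psi>)
      have "(LINT x|lborel. x $ i * grad (\<phi> k) x $ i) = - (LINT x|lborel. \<phi> k x)"
        unfolding eq using i\<psi> i\<phi> integral_partial_test_function[OF \<psi>, of i] by simp
      moreover have "(LINT x|lborel. x $ i * grad (\<phi> k) x $ i) = (LINT x|lebesgue. x $ i * grad (\<phi> k) x $ i)"
        unfolding eq
        by (rule integral_completion[symmetric])
          (use i\<psi> i\<phi> in \<open>auto intro!: borel_measurable_diff\<close>)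
      moreover have "\<dots> = (LINT x|lebesgue_on K. x $ i * grad (\<phi> k) x $ i)"
        by (rule integral_lebesgue_on_eq[OF Kl(1), symmetric]) (simp add: \<phi>_grad c0)
      ultimately show ?thesis
        by (simp add: \<phi>_grad mult_ac)
    qed
    have \<phi>_bound: "\<bar>\<phi> k x\<bar> \<le> C0 * indicator K x" "\<bar>\<phi>' x\<bar> \<le> C0 * indicator K x" for k x
      using C0(2)[OF arg_le(1)[of k x]] C0(2)[OF arg_le(2)[of x]] \<phi>0[of x k] \<phi>'0[of x]
      by (auto simp: \<phi>_def \<phi>'_def indicator_def)
    have intC0: "integrable lborel (\<lambda>x. C0 * indicat_real K x)"
      using emeasure_compact_finite[OF K] Kl
      by (intro integrable_mult_right integrable_real_indicator) auto
    have \<phi>'m: "\<phi>' \<in> borel_measurable borel"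
      by (rule borel_measurable_continuous_onI[OF c_cont(3)])
    have "(\<lambda>k. LINT x|lborel. \<phi> k x) \<longlonglongrightarrow> (LINT x|lborel. \<phi>' x)"
    proof (rule integral_dominated_convergence[OF _ _ intC0])
      show "\<phi>' \<in> borel_measurable lborel" using \<phi>'m by simp
      show "\<phi> k \<in> borel_measurable lborel" for k
        using borel_measurable_continuous_onI[OF smooth_on_continuous[OF \<phi>_smooth]] by simp
    qed (use c_lim(2) \<phi>_bound in auto)
    moreover have "(\<lambda>k. LINT x|lborel. \<phi> k x) \<longlonglongrightarrow> 0"
      unfolding by_parts using tendsto_minus[OF lim0] by simp
    ultimately have "(LINT x|lborel. \<phi>' x) = 0"
      by (rule LIMSEQ_unique)
    moreover have "integrable lborel \<phi>'"
      by (rule Bochner_Integration.integrable_bound[OF intC0]) (use \<phi>'m \<phi>_bound(2) C0(1) in auto)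
    ultimately have "AE x in lborel. \<phi>' x = 0"
      by (subst (asm) integral_nonneg_eq_0_iff_AE) (auto simp: \<phi>'_def)
    then have "\<phi>' y = 0"
      by (rule continuous_AE_eq_0[OF c_cont(3)])
    then show ?thesis
      using flat_exp_pos[of "Z y + (- \<epsilon>)" 0] by (force simp: \<phi>'_def)
  qed
  have "Z x \<le> 0"
    by (rule field_le_epsilon) (simp add: le_eps)
  then show ?thesis
    using x by (simp add: Z_def)
qed

section \<open>Square integrable functions and bounded coefficients\<close>

lemma Linf_on_subset_AE:
  assumes "Linf_on \<Omega> c" "\<Omega> \<in> sets lebesgue" "K \<in> sets lebesgue" "K \<subseteq> \<Omega>"
  obtains C where "0 \<le> C" "AE x in lebesgue_on K. \<bar>c x\<bar> \<le> C" "c \<in> borel_measurable (lebesgue_on K)"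
proof -
  obtain C where C: "AE x in lebesgue_on \<Omega>. \<bar>c x\<bar> \<le> C"
    using assms by (auto simp: Linf_on_def)
  have "AE x in lebesgue. x \<in> \<Omega> \<longrightarrow> \<bar>c x\<bar> \<le> C"
    using C assms(2) by (simp add: AE_restrict_space_iff)
  then have "AE x in lebesgue. x \<in> K \<longrightarrow> \<bar>c x\<bar> \<le> max C 0"
    by eventually_elim (use assms(4) in auto)
  then have "AE x in lebesgue_on K. \<bar>c x\<bar> \<le> max C 0"
    using assms(3) by (simp add: AE_restrict_space_iff)
  moreover have "c \<in> borel_measurable (lebesgue_on K)"
    by (rule measurable_restrict_mono[OF _ assms(4)]) (use assms(1) in \<open>simp add: Linf_on_def\<close>)
  ultimately show ?thesis
    using that[of "max C 0"] by simp
qed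

lemma L2_on_Linf_mult:
  fixes h :: "real^'n \<Rightarrow> real"
  assumes c: "Linf_on \<Omega> c" "\<Omega> \<in> sets lebesgue" and K: "compact K" "K \<subseteq> \<Omega>" and h: "L2_on K h"
  shows "L2_on K (\<lambda>x. c x * h x)"
proof -
  have "K \<in> sets lebesgue" using K by (simp add: compact_imp_closed)
  then obtain C where C: "0 \<le> C" "AE x in lebesgue_on K. \<bar>c x\<bar> \<le> C"
    and cm: "c \<in> borel_measurable (lebesgue_on K)"
    using Linf_on_subset_AE[OF c _ K(2)] by blast
  note h' = L2_onD[OF h]
  have m: "(\<lambda>x. c x * h x) \<in> borel_measurable (lebesgue_on K)"
    using cm h' by simp
  have "integrable (lebesgue_on K) (\<lambda>x. (c x * h x)\<^sup>2)"
  proof (rule Bochner_Integration.integrable_bound)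
    show "integrable (lebesgue_on K) (\<lambda>x. C\<^sup>2 * (h x)\<^sup>2)" using h' by simp
    show "AE x in lebesgue_on K. norm ((c x * h x)\<^sup>2) \<le> norm (C\<^sup>2 * (h x)\<^sup>2)"
      using C(2)
    proof eventually_elim
      case (elim x)
      have "(c x)\<^sup>2 \<le> C\<^sup>2" using power_mono[OF elim, of 2] by simp
      then show ?case by (simp add: power_mult_distrib mult_right_mono)
    qed
  qed (use m in measurable)
  with m show ?thesis by (simp add: L2_on_def)
qed

lemma L2_on_add:
  fixes a b :: "real^'n \<Rightarrow> real"
  assumes "L2_on K a" "L2_on K b"
  shows "L2_on K (\<lambda>x. a x + b x)"
proof -
  note a = L2_onD[OF assms(1)] and b = L2_onD[OF assms(2)]
  have "integrable (lebesgue_on K) (\<lambda>x. (a x)\<^sup>2 + (b x)\<^sup>2 + 2 * (a x * b x))"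
    using a b integrable_mult_L2[OF a(1) b(1) a(2) b(2)] by simp
  then show ?thesis
    using a b by (simp add: L2_on_def power2_sum mult.assoc)
qed

lemma L2_on_sum:
  fixes a :: "'i \<Rightarrow> real^'n \<Rightarrow> real"
  assumes "finite I" "\<And>i. i \<in> I \<Longrightarrow> L2_on K (a i)"
  shows "L2_on K (\<lambda>x. \<Sum>i\<in>I. a i x)"
  using assms
proof (induction I rule: finite_induct)
  case empty
  then show ?case by (simp add: L2_on_def)
next
  case (insert i I)
  then show ?case using L2_on_add[of K "a i" "\<lambda>x. \<Sum>i\<in>I. a i x"] by simp
qed

lemma L2_on_vectorI:
  fixes g :: "real^'n \<Rightarrow> real^'n"
  assumes "\<And>i. L2_on K (\<lambda>x. g x $ i)"
  shows "L2_on K g"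
proof -
  have "g \<in> borel_measurable (lebesgue_on K)"
    using assms by (subst borel_measurable_euclidean_space)
      (auto simp: L2_on_def Basis_vec_def inner_axis)
  moreover have "(norm (g x))\<^sup>2 = (\<Sum>i\<in>UNIV. (g x $ i)\<^sup>2)" for x
    unfolding power2_norm_eq_inner inner_vec_def by (simp add: power2_eq_square)
  ultimately show ?thesis
    using assms by (simp add: L2_on_def)
qed

text \<open>Integrals in Isabelle/HOL are zero for functions that are not integrable, so splitting the weak
  equation into its parts requires the integrability of each part; this lemma supplies it.\<close>

lemma integrable_L2_loc_test:
  fixes h :: "real^'n \<Rightarrow> real"
  assumes h: "L2_loc \<Omega> h" and \<phi>: "\<phi> \<in> test_functions \<Omega>" and \<Omega>: "\<Omega> \<in> sets lebesgue"
  shows "integrable (lebesgue_on \<Omega>) (\<lambda>x. h x * \<phi> x)"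
proof -
  obtain K where K: "smooth_on UNIV \<phi>" "compact K" "K \<subseteq> \<Omega>" "\<And>x. x \<notin> K \<Longrightarrow> \<phi> x = 0"
    by (rule test_functionsE[OF \<phi>]) blast
  have Kl: "K \<in> sets lebesgue" using K by (simp add: compact_imp_closed)
  have hK: "L2_on K h" using h K by (simp add: L2_loc_def)
  have \<phi>K: "L2_on K \<phi>"
    by (rule L2_on_continuous[OF continuous_on_subset[OF smooth_on_continuous[OF K(1)]] K(2)]) simp
  have "integrable (lebesgue_on K) (\<lambda>x. h x * \<phi> x)"
    by (rule integrable_mult_L2[OF L2_onD(1)[OF hK] L2_onD(1)[OF \<phi>K] L2_onD(2)[OF hK] L2_onD(2)[OF \<phi>K]])
  then have "integrable lebesgue (\<lambda>x. indicator K x *\<^sub>R (h x * \<phi> x))"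
    using Kl by (simp add: integrable_restrict_space)
  moreover have "(\<lambda>x. indicator K x *\<^sub>R (h x * \<phi> x)) = (\<lambda>x. indicator \<Omega> x *\<^sub>R (h x * \<phi> x))"
    using K(3,4) by (force simp: indicator_def)
  ultimately show ?thesis
    using \<Omega> by (simp add: integrable_restrict_space)
qed

lemma L2_loc_component:
  fixes g :: "real^'n \<Rightarrow> real^'n"
  shows "L2_loc \<Omega> g \<Longrightarrow> L2_loc \<Omega> (\<lambda>x. g x $ i)"
  by (simp add: L2_loc_def L2_on_component)

lemma L2_loc_Linf_mult:
  fixes h :: "real^'n \<Rightarrow> real"
  assumes "Linf_on \<Omega> c" "\<Omega> \<in> sets lebesgue" "L2_loc \<Omega> h"
  shows "L2_loc \<Omega> (\<lambda>x. c x * h x)"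
  using assms by (auto simp: L2_loc_def intro: L2_on_Linf_mult)

lemma L2_loc_const: "L2_loc \<Omega> (\<lambda>x::real^'n. c :: real)"
  by (auto simp: L2_loc_def intro: L2_on_continuous)

lemma Linf_on_const: "Linf_on \<Omega> (\<lambda>x. c)"
  by (auto simp: Linf_on_def)

lemma L2_loc_Linf:
  fixes c :: "real^'n \<Rightarrow> real"
  assumes "Linf_on \<Omega> c" "\<Omega> \<in> sets lebesgue"
  shows "L2_loc \<Omega> c"
  using L2_loc_Linf_mult[OF assms L2_loc_const[of \<Omega> 1]] by simp

lemma L2_loc_matrix_vector:
  fixes A :: "real^'n \<Rightarrow> real^'n^'n" and g :: "real^'n \<Rightarrow> real^'n"
  assumes A: "\<And>i j. Linf_on \<Omega> (\<lambda>x. A x $ i $ j)" and \<Omega>: "\<Omega> \<in> sets lebesgue" and g: "L2_loc \<Omega> g"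
  shows "L2_loc \<Omega> (\<lambda>x. A x *v g x)"
  unfolding L2_loc_def
proof (intro allI impI L2_on_vectorI)
  fix K :: "(real^'n) set" and i
  assume K: "compact K \<and> K \<subseteq> \<Omega>"
  then have "L2_on K (\<lambda>x. \<Sum>j\<in>UNIV. A x $ i $ j * g x $ j)"
    using g by (intro L2_on_sum L2_on_Linf_mult[OF A \<Omega>] L2_on_component) (auto simp: L2_loc_def)
  then show "L2_on K (\<lambda>x. (A x *v g x) $ i)"
    by (simp add: matrix_vector_mult_def)
qed

text \<open>The weak equation in the form in which it is used: the flux is locally square integrable, every
  term is integrable, and the zeroth order term stands on the right.\<close>

lemma weak_L_eq_flux:
  assumes A: "\<And>i j. Linf_on \<Omega> (\<lambda>x. A x $ i $ j)" and V: "Linf_on \<Omega> V" and \<Omega>: "\<Omega> \<in> sets lebesgue"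
    and eq: "weak_L_eq \<Omega> A V w f"
  obtains g where "L2_loc \<Omega> w" "L2_loc \<Omega> g" "has_weak_grad \<Omega> w g" "L2_loc \<Omega> (\<lambda>x. A x *v g x)"
    "\<And>\<phi>. \<phi> \<in> test_functions \<Omega> \<Longrightarrow> integrable (lebesgue_on \<Omega>) (\<lambda>x. (A x *v g x) \<bullet> grad \<phi> x)"
    "\<And>\<phi>. \<phi> \<in> test_functions \<Omega> \<Longrightarrow> integrable (lebesgue_on \<Omega>) (\<lambda>x. V x * w x * \<phi> x)"
    "\<And>\<phi>. \<phi> \<in> test_functions \<Omega> \<Longrightarrow> (LINT x|lebesgue_on \<Omega>. (A x *v g x) \<bullet> grad \<phi> x)
      = (LINT x|lebesgue_on \<Omega>. f x * \<phi> x) - (LINT x|lebesgue_on \<Omega>. V x * w x * \<phi> x)"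
proof -
  obtain g where g: "H1_loc_grad \<Omega> w g"
    and weak: "\<And>\<phi>. \<phi> \<in> test_functions \<Omega> \<Longrightarrow>
      (LINT x|lebesgue_on \<Omega>. (A x *v g x) \<bullet> grad \<phi> x + V x * w x * \<phi> x) = (LINT x|lebesgue_on \<Omega>. f x * \<phi> x)"
    using eq unfolding weak_L_eq_def by blast
  have w: "L2_loc \<Omega> w" and g2: "L2_loc \<Omega> g" and wg: "has_weak_grad \<Omega> w g"
    using g by (auto simp: H1_loc_grad_def)
  have flux: "L2_loc \<Omega> (\<lambda>x. A x *v g x)"
    by (rule L2_loc_matrix_vector[OF A \<Omega> g2])
  have i1: "integrable (lebesgue_on \<Omega>) (\<lambda>x. (A x *v g x) \<bullet> grad \<phi> x)" if "\<phi> \<in> test_functions \<Omega>" for \<phi>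
    unfolding inner_vec_def inner_real_def
    by (intro Bochner_Integration.integrable_sum integrable_L2_loc_test[OF _ _ \<Omega>]
        L2_loc_component[OF flux] test_functions_partial[OF that])
  have i2: "integrable (lebesgue_on \<Omega>) (\<lambda>x. V x * w x * \<phi> x)" if "\<phi> \<in> test_functions \<Omega>" for \<phi>
    by (rule integrable_L2_loc_test[OF L2_loc_Linf_mult[OF V \<Omega> w] that \<Omega>])
  have "(LINT x|lebesgue_on \<Omega>. (A x *v g x) \<bullet> grad \<phi> x)
      = (LINT x|lebesgue_on \<Omega>. f x * \<phi> x) - (LINT x|lebesgue_on \<Omega>. V x * w x * \<phi> x)"
    if "\<phi> \<in> test_functions \<Omega>" for \<phi>
    using weak[OF that] i1[OF that] i2[OF that] by simp
  then show ?thesis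
    using that[OF w g2 wg flux i1 i2] by blast
qed

section \<open>Polygonal domains\<close>

lemma polygonal_domain_frontier_negligible:
  assumes "polygonal_domain S"
  shows "negligible (frontier S)"
proof -
  have "\<exists>F. finite F \<and> (\<forall>s\<in>F. \<exists>a b. a \<noteq> b \<and> s = closed_segment a b) \<and> frontier S = \<Union>F"
    using assms by (simp add: polygonal_domain_def)
  then obtain F where F: "finite F" "\<forall>s\<in>F. \<exists>a b. a \<noteq> b \<and> s = closed_segment a b" "frontier S = \<Union>F"
    by (elim exE conjE)
  have "negligible s" if s: "s \<in> F" for s
  proof -
    obtain a b where "s = closed_segment a b" using bspec[OF F(2) s] by (elim exE conjE)
    moreover have "interior (closed_segment a b) = {}"
      by (rule interior_closed_segment_ge2) simp
    ultimately show ?thesis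
      using negligible_convex_interior[of s] by simp
  qed
  then show ?thesis
    unfolding F(3) by (intro negligible_Union F(1)) auto
qed

text \<open>The subdomains cover the domain up to their frontiers, which are negligible as finite unions of
  segments. Inside a subdomain the function is continuous, and it is bounded because it extends
  continuously to the compact closure.\<close>

lemma Linf_on_piecewise_smooth:
  assumes \<Omega>: "polygonal_domain \<Omega>" and D: "polygonal_partition \<Omega> m D"
    and c: "\<And>k. k \<in> {1..m} \<Longrightarrow> smooth_up_to_closure (D k) c"
  shows "Linf_on \<Omega> c"
proof -
  define S where "S = (\<Union>k\<in>{1..m}. D k)"
  \<comment> \<open>The part of the interfaces inside \<open>\<Omega>\<close>, where nothing is known about the values of \<open>c\<close>.\<close>
  define N where "N = \<Omega> - S"
  have Dk: "polygonal_domain (D k)" "D k \<subseteq> \<Omega>" if "k \<in> {1..m}" for k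
    using D that by (auto simp: polygonal_partition_def)
  have \<Omega>o: "open \<Omega>" and So: "open S"
    using \<Omega> Dk by (auto simp: polygonal_domain_def S_def)
  then have \<Omega>l: "\<Omega> \<in> sets lebesgue" and Sl: "S \<in> sets lebesgue" by auto
  have "negligible N"
  proof (rule negligible_subset)
    show "negligible (\<Union>k\<in>{1..m}. frontier (D k))"
      using Dk by (intro negligible_Union) (auto intro: polygonal_domain_frontier_negligible)
    show "N \<subseteq> (\<Union>k\<in>{1..m}. frontier (D k))"
    proof
      fix x assume x: "x \<in> N"
      then have "x \<in> closure \<Omega>" using closure_subset by (auto simp: N_def)
      then obtain k where k: "k \<in> {1..m}" "x \<in> closure (D k)"
        using D by (auto simp: polygonal_partition_def)
      moreover have "x \<notin> D k" using x k(1) by (auto simp: N_def S_def)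
      ultimately show "x \<in> (\<Union>k\<in>{1..m}. frontier (D k))"
        using Dk(1)[OF k(1)] by (auto simp: frontier_def interior_open polygonal_domain_def)
    qed
  qed
  then have N: "N \<in> null_sets (lebesgue_on \<Omega>)"
    using \<Omega>l by (auto simp: negligible_iff_null_sets null_sets_restrict_space N_def)
  have S_eq: "\<Omega> - N = S"
  proof -
    have "S \<subseteq> \<Omega>" unfolding S_def using Dk(2) by blast
    then show ?thesis by (auto simp: N_def)
  qed
  have diff: "c differentiable (at x)" if x: "x \<in> S" for x
  proof -
    obtain k where k: "k \<in> {1..m}" "x \<in> D k" using x by (auto simp: S_def)
    then have "smooth_on (D k) c" using c[OF k(1)] by (simp add: smooth_up_to_closure_def)
    then show ?thesis by (rule smooth_on_differentiable[OF _ k(2)])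
  qed
  have "continuous_on S c"
    by (intro continuous_at_imp_continuous_on ballI differentiable_imp_continuous_within diff)
  then have "c \<in> borel_measurable (lebesgue_on S)"
    using Sl by (rule continuous_imp_measurable_on_sets_lebesgue)
  then have m: "c \<in> borel_measurable (lebesgue_on \<Omega>)"
    using borel_measurable_diff_null[OF N \<Omega>l, of c] by (simp add: S_eq)
  have "\<exists>C. \<forall>x\<in>D k. \<bar>c x\<bar> \<le> C" if k: "k \<in> {1..m}" for k
  proof -
    obtain h where h: "continuous_on (closure (D k)) h" "\<And>x. x \<in> D k \<Longrightarrow> h x = c x"
      using c[OF k] unfolding smooth_up_to_closure_def by (metis iter_partial.simps(1))
    have "compact (closure (D k))"
      using Dk(1)[OF k] by (simp add: polygonal_domain_def)
    then have "bounded (h ` closure (D k))"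
      using h(1) by (intro compact_imp_bounded compact_continuous_image)
    then obtain C where "\<And>x. x \<in> closure (D k) \<Longrightarrow> \<bar>h x\<bar> \<le> C"
      by (auto simp: bounded_iff)
    then show ?thesis
      using h(2) closure_subset[of "D k"] by (metis subset_iff)
  qed
  then obtain C where C: "\<And>k x. k \<in> {1..m} \<Longrightarrow> x \<in> D k \<Longrightarrow> \<bar>c x\<bar> \<le> C k"
    by metis
  have bound: "\<bar>c x\<bar> \<le> (\<Sum>k\<in>{1..m}. \<bar>C k\<bar>)" if x: "x \<in> S" for x
  proof -
    obtain k where k: "k \<in> {1..m}" "x \<in> D k" using x by (auto simp: S_def)
    have "\<bar>c x\<bar> \<le> \<bar>C k\<bar>" using C[OF k] by linarith
    also have "\<dots> \<le> (\<Sum>k\<in>{1..m}. \<bar>C k\<bar>)"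
      by (rule member_le_sum[OF k(1)]) auto
    finally show ?thesis .
  qed
  have "AE x in lebesgue_on \<Omega>. \<bar>c x\<bar> \<le> (\<Sum>k\<in>{1..m}. \<bar>C k\<bar>)"
    by (rule AE_I'[OF N]) (use bound in \<open>auto simp: N_def\<close>)
  with m show ?thesis
    by (auto simp: Linf_on_def)
qed

text \<open>The essential supremum over the boundary is an actual bound: every boundary point lies on a
  nondegenerate boundary segment, and a violation at one point of the segment would, by continuity,
  persist on a parameter interval of positive length.\<close>

lemma
  assumes \<Omega>: "polygonal_domain \<Omega>" and v: "continuous_on (closure \<Omega>) v"
  shows abs_le_Linf_norm_boundary: "x \<in> frontier \<Omega> \<Longrightarrow> \<bar>v x\<bar> \<le> Linf_norm_boundary \<Omega> v"
    and Linf_norm_boundary_nonneg: "0 \<le> Linf_norm_boundary \<Omega> v"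
proof -
  let ?X = "{C. 0 \<le> C \<and> arclength_null (frontier \<Omega>) {x\<in>frontier \<Omega>. \<bar>v x\<bar> > C}}"
  have "bounded \<Omega>" using \<Omega> by (simp add: polygonal_domain_def)
  then have "compact (frontier \<Omega>)" by (rule compact_frontier_bounded)
  moreover have vf: "continuous_on (frontier \<Omega>) v"
    using v by (rule continuous_on_subset) (simp add: frontier_def)
  ultimately have "bounded (v ` frontier \<Omega>)"
    by (intro compact_imp_bounded compact_continuous_image)
  then obtain C where C: "\<And>x. x \<in> frontier \<Omega> \<Longrightarrow> \<bar>v x\<bar> \<le> C"
    by (auto simp: bounded_iff)
  have empty: "{x\<in>frontier \<Omega>. \<bar>v x\<bar> > max C 0} = {}"
    using C by force
  have "arclength_null (frontier \<Omega>) {x\<in>frontier \<Omega>. \<bar>v x\<bar> > max C 0}"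
    unfolding empty by (simp add: arclength_null_def)
  then have "max C 0 \<in> ?X" by simp
  then have ne: "?X \<noteq> {}" by blast
  show "0 \<le> Linf_norm_boundary \<Omega> v"
    unfolding Linf_norm_boundary_def by (rule cInf_greatest[OF ne]) auto
  assume x: "x \<in> frontier \<Omega>"
  show "\<bar>v x\<bar> \<le> Linf_norm_boundary \<Omega> v"
    unfolding Linf_norm_boundary_def
  proof (rule cInf_greatest[OF ne])
    fix C assume "C \<in> ?X"
    then have null: "arclength_null (frontier \<Omega>) {x\<in>frontier \<Omega>. \<bar>v x\<bar> > C}" by simp
    obtain a b where ab: "a \<noteq> b" "x \<in> closed_segment a b" "closed_segment a b \<subseteq> frontier \<Omega>"
      using \<Omega> x unfolding polygonal_domain_def by (metis Union_iff Union_upper)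
    define p where "p t = \<bar>v (linepath a b t)\<bar>" for t
    have seg: "linepath a b t \<in> frontier \<Omega>" if "t \<in> {0..1}" for t
      using linepath_in_path[of t a b] that ab(3) by blast
    have p: "continuous_on {0..1} p"
      unfolding p_def[abs_def]
      by (intro continuous_intros continuous_on_compose2[OF vf continuous_on_linepath]) (use seg in auto)
    obtain t0 where t0: "t0 \<in> {0..1}" "x = linepath a b t0"
      using ab(2) by (metis imageE linepath_image_01)
    show "\<bar>v x\<bar> \<le> C"
    proof (rule ccontr)
      assume "\<not> \<bar>v x\<bar> \<le> C"
      then have "C < p t0" by (simp add: p_def t0)
      then obtain d where d: "0 < d" "\<And>t. t \<in> {0..1} \<Longrightarrow> \<bar>t - t0\<bar> < d \<Longrightarrow> \<bar>p t - p t0\<bar> < p t0 - C"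
        using p t0(1) unfolding continuous_on_iff dist_real_def by (metis diff_gt_0_iff_gt)
      define l where "l = max 0 (t0 - d / 2)"
      define r where "r = min 1 (t0 + d / 2)"
      have lr: "l < r" "{l..r} \<subseteq> {0..1}" "\<And>t. t \<in> {l..r} \<Longrightarrow> \<bar>t - t0\<bar> < d"
        using t0(1) d(1) by (auto simp: l_def r_def abs_if)
      have "{l..r} \<subseteq> {t\<in>{0..1}. linepath a b t \<in> {x\<in>frontier \<Omega>. \<bar>v x\<bar> > C}}"
      proof
        fix t assume t: "t \<in> {l..r}"
        then have t01: "t \<in> {0..1}" using lr(2) by blast
        have "C < p t" using d(2)[OF t01 lr(3)[OF t]] by linarith
        then show "t \<in> {t\<in>{0..1}. linepath a b t \<in> {x\<in>frontier \<Omega>. \<bar>v x\<bar> > C}}"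
          using t01 seg[OF t01] by (simp add: p_def)
      qed
      moreover have "{t\<in>{0..1}. linepath a b t \<in> {x\<in>frontier \<Omega>. \<bar>v x\<bar> > C}} \<in> null_sets lebesgue"
        using null ab unfolding arclength_null_def by blast
      ultimately have "negligible {l..r}"
        using negligible_iff_null_sets negligible_subset by blast
      then show False
        using lr(1) negligible_interval(1)[of l r] by (simp add: box_real)
    qed
  qed
qed

text \<open>The norm is the real part of an extended real essential supremum, which would be \<open>0\<close> if that
  supremum were infinite. It is finite: essential boundedness excludes \<open>\<infinity>\<close>, and since a nonempty open
  set is not negligible, some value \<open>\<bar>f x\<bar>\<close> lies below the supremum, which excludes \<open>- \<infinity>\<close>.\<close>

lemma AE_abs_le_Linf_norm:
  assumes f: "Linf_on \<Omega> f" and \<Omega>: "open \<Omega>" "\<Omega> \<noteq> {}"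
  shows "AE x in lebesgue_on \<Omega>. \<bar>f x\<bar> \<le> Linf_norm \<Omega> f"
proof -
  let ?e = "esssup (lebesgue_on \<Omega>) (\<lambda>x. ereal \<bar>f x\<bar>)"
  obtain C where C: "AE x in lebesgue_on \<Omega>. \<bar>f x\<bar> \<le> C" and m: "f \<in> borel_measurable (lebesgue_on \<Omega>)"
    using f by (auto simp: Linf_on_def)
  have "?e \<le> ereal C"
    by (rule esssup_I) (use m C in auto)
  then have lt: "?e \<noteq> \<infinity>" by auto
  have AE: "AE x in lebesgue_on \<Omega>. ereal \<bar>f x\<bar> \<le> ?e"
    by (rule esssup_AE)
  have "\<exists>x\<in>\<Omega>. ereal \<bar>f x\<bar> \<le> ?e"
  proof (rule ccontr)
    assume "\<not> ?thesis"
    then have "AE x in lebesgue_on \<Omega>. x \<notin> \<Omega>"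
      using AE by (auto elim!: eventually_mono)
    then have "AE x in lebesgue. x \<notin> \<Omega>"
      using \<Omega>(1) by (auto simp: AE_restrict_space_iff elim!: eventually_mono)
    then have "\<Omega> \<in> null_sets lebesgue"
      using \<Omega>(1) by (subst AE_iff_null_sets) auto
    then show False
      using open_not_negligible[OF \<Omega>] by (simp add: negligible_iff_null_sets)
  qed
  then obtain x where "ereal \<bar>f x\<bar> \<le> ?e" by blast
  moreover have "(0::ereal) \<le> ereal \<bar>f x\<bar>" by simp
  ultimately have e0: "0 \<le> ?e" by (rule order_trans[rotated])
  then have e: "?e = ereal (Linf_norm \<Omega> f)"
    unfolding Linf_norm_def using lt by (auto simp: ereal_real)
  show ?thesis
    using AE unfolding e by simp
qed

section \<open>The landscape bound\<close>

text \<open>The constant \<open>c\<close> has weak gradient zero because partial derivatives of test functions integrate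
  to zero.\<close>

lemma has_weak_grad_combination:
  fixes v w :: "real^'n \<Rightarrow> real"
  assumes \<Omega>: "\<Omega> \<in> sets lebesgue"
    and v: "L2_loc \<Omega> v" "L2_loc \<Omega> g" "has_weak_grad \<Omega> v g"
    and w: "L2_loc \<Omega> w" "L2_loc \<Omega> h" "has_weak_grad \<Omega> w h"
  shows "has_weak_grad \<Omega> (\<lambda>x. a * v x + b * w x + c) (\<lambda>x. a *\<^sub>R g x + b *\<^sub>R h x)"
  unfolding has_weak_grad_def
proof (intro ballI allI)
  fix \<phi> i assume \<phi>: "\<phi> \<in> test_functions \<Omega>"
  note \<phi>i = test_functions_partial[OF \<phi>, of i]
  obtain K where K: "K \<subseteq> \<Omega>" "\<And>x. x \<notin> K \<Longrightarrow> grad \<phi> x = 0"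
    by (rule test_functionsE[OF \<phi>]) blast
  note int = integrable_L2_loc_test[OF v(1) \<phi>i \<Omega>] integrable_L2_loc_test[OF w(1) \<phi>i \<Omega>]
    integrable_L2_loc_test[OF L2_loc_const[of \<Omega> c] \<phi>i \<Omega>]
    integrable_L2_loc_test[OF L2_loc_component[OF v(2), of i] \<phi> \<Omega>]
    integrable_L2_loc_test[OF L2_loc_component[OF w(2), of i] \<phi> \<Omega>]
  have "(LINT x|lebesgue_on \<Omega>. grad \<phi> x $ i) = (LINT x|lebesgue. grad \<phi> x $ i)"
    by (rule integral_lebesgue_on_eq[OF \<Omega>]) (use K in force)
  also have "\<dots> = (LINT x|lborel. grad \<phi> x $ i)"
    by (rule integral_completion) (use test_functions_integrable(2)[OF \<phi>i] in simp)
  also have "\<dots> = 0"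
    by (rule integral_partial_test_function[OF \<phi>])
  finally have const: "(LINT x|lebesgue_on \<Omega>. c * grad \<phi> x $ i) = 0"
    by simp
  have "(LINT x|lebesgue_on \<Omega>. (a * v x + b * w x + c) * grad \<phi> x $ i)
      = (LINT x|lebesgue_on \<Omega>. a * (v x * grad \<phi> x $ i) + b * (w x * grad \<phi> x $ i) + c * grad \<phi> x $ i)"
    by (simp add: algebra_simps)
  also have "\<dots> = a * (LINT x|lebesgue_on \<Omega>. v x * grad \<phi> x $ i) + b * (LINT x|lebesgue_on \<Omega>. w x * grad \<phi> x $ i)"
    using int const by simp
  also have "\<dots> = - (LINT x|lebesgue_on \<Omega>. a * (g x $ i * \<phi> x) + b * (h x $ i * \<phi> x))"
    using int has_weak_gradD[OF v(3) \<phi>, of i] has_weak_gradD[OF w(3) \<phi>, of i] by simp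
  also have "\<dots> = - (LINT x|lebesgue_on \<Omega>. (a *\<^sub>R g x + b *\<^sub>R h x) $ i * \<phi> x)"
    by (simp add: algebra_simps)
  finally show "(LINT x|lebesgue_on \<Omega>. (a * v x + b * w x + c) * grad \<phi> x $ i)
      = - (LINT x|lebesgue_on \<Omega>. (a *\<^sub>R g x + b *\<^sub>R h x) $ i * \<phi> x)" .
qed

lemma L2_loc_combination:
  fixes g h :: "real^'n \<Rightarrow> real^'n"
  assumes \<Omega>: "\<Omega> \<in> sets lebesgue" and "L2_loc \<Omega> g" "L2_loc \<Omega> h"
  shows "L2_loc \<Omega> (\<lambda>x. a *\<^sub>R g x + b *\<^sub>R h x)"
  unfolding L2_loc_def
proof (intro allI impI L2_on_vectorI)
  fix K :: "(real^'n) set" and i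
  assume K: "compact K \<and> K \<subseteq> \<Omega>"
  have "L2_on K (\<lambda>x. a * g x $ i + b * h x $ i)"
    using assms K by (intro L2_on_add L2_on_Linf_mult[OF Linf_on_const \<Omega>] L2_on_component) (auto simp: L2_loc_def)
  then show "L2_on K (\<lambda>x. (a *\<^sub>R g x + b *\<^sub>R h x) $ i)"
    by simp
qed

text \<open>One half of the bound, for a fixed sign \<open>s\<close>. The difference \<open>s * v - F * u - M\<close> satisfies the
  hypothesis of the maximum principle: on the support of the test function it is positive, which
  makes \<open>s * v - F * u\<close> positive as well, and the potential term can be dropped.\<close>

lemma subsolution_le_landscape:
  fixes \<Omega> :: "(real^2) set" and A :: "real^2 \<Rightarrow> real^2^2"
  assumes \<Omega>: "open \<Omega>" "bounded \<Omega>"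
    and A: "\<And>i j. Linf_on \<Omega> (\<lambda>x. A x $ i $ j)" and V: "Linf_on \<Omega> V" "\<And>x. x \<in> \<Omega> \<Longrightarrow> 0 \<le> V x"
    and ell: "0 < \<alpha>" "AE x in lebesgue_on \<Omega>. \<forall>\<xi>. \<xi> \<bullet> (A x *v \<xi>) \<ge> \<alpha> * (norm \<xi>)\<^sup>2"
    and u: "weak_L_eq \<Omega> A V u (\<lambda>x. 1)" "continuous_on (closure \<Omega>) u"
    and v: "weak_L_eq \<Omega> A V v f" "continuous_on (closure \<Omega>) v" and f: "Linf_on \<Omega> f"
    and F: "AE x in lebesgue_on \<Omega>. s * f x \<le> F"
    and M: "0 \<le> M" "\<And>x. x \<in> frontier \<Omega> \<Longrightarrow> s * v x \<le> M + F * u x"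
    and x: "x \<in> \<Omega>"
  shows "s * v x \<le> M + F * u x"
proof -
  have \<Omega>l: "\<Omega> \<in> sets lebesgue" using \<Omega>(1) by simp
  obtain gu where u2: "L2_loc \<Omega> u" "L2_loc \<Omega> gu" "has_weak_grad \<Omega> u gu" "L2_loc \<Omega> (\<lambda>x. A x *v gu x)"
    and u_int: "\<And>\<phi>. \<phi> \<in> test_functions \<Omega> \<Longrightarrow> integrable (lebesgue_on \<Omega>) (\<lambda>x. (A x *v gu x) \<bullet> grad \<phi> x)"
      "\<And>\<phi>. \<phi> \<in> test_functions \<Omega> \<Longrightarrow> integrable (lebesgue_on \<Omega>) (\<lambda>x. V x * u x * \<phi> x)"
    and u_eq: "\<And>\<phi>. \<phi> \<in> test_functions \<Omega> \<Longrightarrow> (LINT x|lebesgue_on \<Omega>. (A x *v gu x) \<bullet> grad \<phi> x)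
      = (LINT x|lebesgue_on \<Omega>. 1 * \<phi> x) - (LINT x|lebesgue_on \<Omega>. V x * u x * \<phi> x)"
    by (rule weak_L_eq_flux[OF A V(1) \<Omega>l u(1)]) blast
  obtain gv where v2: "L2_loc \<Omega> v" "L2_loc \<Omega> gv" "has_weak_grad \<Omega> v gv" "L2_loc \<Omega> (\<lambda>x. A x *v gv x)"
    and v_int: "\<And>\<phi>. \<phi> \<in> test_functions \<Omega> \<Longrightarrow> integrable (lebesgue_on \<Omega>) (\<lambda>x. (A x *v gv x) \<bullet> grad \<phi> x)"
      "\<And>\<phi>. \<phi> \<in> test_functions \<Omega> \<Longrightarrow> integrable (lebesgue_on \<Omega>) (\<lambda>x. V x * v x * \<phi> x)"
    and v_eq: "\<And>\<phi>. \<phi> \<in> test_functions \<Omega> \<Longrightarrow> (LINT x|lebesgue_on \<Omega>. (A x *v gv x) \<bullet> grad \<phi> x)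
      = (LINT x|lebesgue_on \<Omega>. f x * \<phi> x) - (LINT x|lebesgue_on \<Omega>. V x * v x * \<phi> x)"
    by (rule weak_L_eq_flux[OF A V(1) \<Omega>l v(1)]) blast
  define z where "z x = s * v x + (- F) * u x + (- M)" for x
  define g where "g x = s *\<^sub>R gv x + (- F) *\<^sub>R gu x" for x
  define B where "B x = A x *v g x" for x
  have B_eq: "B x = s *\<^sub>R (A x *v gv x) + (- F) *\<^sub>R (A x *v gu x)" for x
    by (simp add: B_def g_def matrix_vector_right_distrib matrix_vector_mult_scaleR
      matrix_vector_mult_diff_distrib)
  have "z x \<le> 0"
  proof (rule weak_maximum_principle[OF \<Omega> _ _ _ _ _ ell(1) _ _ x])
    show "continuous_on (closure \<Omega>) z"
      unfolding z_def[abs_def] using u(2) v(2) by (intro continuous_intros)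
    show "z y \<le> 0" if "y \<in> frontier \<Omega>" for y
      using M(2)[OF that] by (simp add: z_def)
    show "has_weak_grad \<Omega> z g"
      unfolding z_def[abs_def] g_def[abs_def]
      by (rule has_weak_grad_combination[OF \<Omega>l v2(1-3) u2(1-3)])
    show "L2_loc \<Omega> g"
      unfolding g_def[abs_def] by (rule L2_loc_combination[OF \<Omega>l v2(2) u2(2)])
    show "L2_loc \<Omega> B"
      unfolding B_eq[abs_def] by (rule L2_loc_combination[OF \<Omega>l v2(4) u2(4)])
    show "AE x in lebesgue_on \<Omega>. \<alpha> * (norm (g x))\<^sup>2 \<le> B x \<bullet> g x"
      using ell(2) by eventually_elim (simp add: B_def inner_commute)
  next
    fix \<phi> assume \<phi>: "\<phi> \<in> test_functions \<Omega>" and nn: "\<And>x. 0 \<le> \<phi> x" and supp: "\<And>x. \<phi> x \<noteq> 0 \<Longrightarrow> 0 < z x"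
    have i\<phi>: "integrable (lebesgue_on \<Omega>) \<phi>"
      using integrable_L2_loc_test[OF L2_loc_const[of \<Omega> 1] \<phi> \<Omega>l] by simp
    have if\<phi>: "integrable (lebesgue_on \<Omega>) (\<lambda>x. f x * \<phi> x)"
      by (rule integrable_L2_loc_test[OF L2_loc_Linf[OF f \<Omega>l] \<phi> \<Omega>l])
    have "(LINT x|lebesgue_on \<Omega>. B x \<bullet> grad \<phi> x) =
        (LINT x|lebesgue_on \<Omega>. s * ((A x *v gv x) \<bullet> grad \<phi> x) + (- F) * ((A x *v gu x) \<bullet> grad \<phi> x))"
      by (simp add: B_eq inner_add_left inner_diff_left)
    also have "\<dots> = s * (LINT x|lebesgue_on \<Omega>. (A x *v gv x) \<bullet> grad \<phi> x)
        - F * (LINT x|lebesgue_on \<Omega>. (A x *v gu x) \<bullet> grad \<phi> x)"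
      using v_int(1)[OF \<phi>] u_int(1)[OF \<phi>] by simp
    also have "\<dots> = (LINT x|lebesgue_on \<Omega>. (s * f x - F) * \<phi> x)
        - (LINT x|lebesgue_on \<Omega>. V x * (s * v x - F * u x) * \<phi> x)"
    proof -
      have "(LINT x|lebesgue_on \<Omega>. (s * f x - F) * \<phi> x) =
          (LINT x|lebesgue_on \<Omega>. s * (f x * \<phi> x) - F * \<phi> x)"
        by (simp add: algebra_simps)
      also have "\<dots> = s * (LINT x|lebesgue_on \<Omega>. f x * \<phi> x) - F * (LINT x|lebesgue_on \<Omega>. \<phi> x)"
        using i\<phi> if\<phi> by simp
      finally have 1: "(LINT x|lebesgue_on \<Omega>. (s * f x - F) * \<phi> x) =
          s * (LINT x|lebesgue_on \<Omega>. f x * \<phi> x) - F * (LINT x|lebesgue_on \<Omega>. \<phi> x)" .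
      have "(LINT x|lebesgue_on \<Omega>. V x * (s * v x - F * u x) * \<phi> x) =
          (LINT x|lebesgue_on \<Omega>. s * (V x * v x * \<phi> x) - F * (V x * u x * \<phi> x))"
        by (simp add: algebra_simps)
      also have "\<dots> = s * (LINT x|lebesgue_on \<Omega>. V x * v x * \<phi> x) - F * (LINT x|lebesgue_on \<Omega>. V x * u x * \<phi> x)"
        using v_int(2)[OF \<phi>] u_int(2)[OF \<phi>] by simp
      finally have 2: "(LINT x|lebesgue_on \<Omega>. V x * (s * v x - F * u x) * \<phi> x) =
          s * (LINT x|lebesgue_on \<Omega>. V x * v x * \<phi> x) - F * (LINT x|lebesgue_on \<Omega>. V x * u x * \<phi> x)" .
      show ?thesis
        unfolding 1 2 v_eq[OF \<phi>] u_eq[OF \<phi>] by (simp add: right_diff_distrib)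
    qed
    also have "\<dots> \<le> 0 - 0"
    proof (rule diff_mono)
      have "0 \<le> (LINT x|lebesgue_on \<Omega>. (F - s * f x) * \<phi> x)"
        by (rule integral_nonneg_AE) (use F in eventually_elim, simp add: nn)
      also have "\<dots> = - (LINT x|lebesgue_on \<Omega>. (s * f x - F) * \<phi> x)"
        by (simp add: algebra_simps flip: Bochner_Integration.integral_minus)
      finally show "(LINT x|lebesgue_on \<Omega>. (s * f x - F) * \<phi> x) \<le> 0" by simp
      show "0 \<le> (LINT x|lebesgue_on \<Omega>. V x * (s * v x - F * u x) * \<phi> x)"
      proof (rule integral_nonneg_AE, rule AE_I2)
        fix x assume "x \<in> space (lebesgue_on \<Omega>)"
        then have x: "x \<in> \<Omega>" by simp
        show "0 \<le> V x * (s * v x - F * u x) * \<phi> x"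
        proof (cases "\<phi> x = 0")
          case False
          then have "0 \<le> s * v x - F * u x" using supp[of x] M(1) by (simp add: z_def)
          then show ?thesis using V(2)[OF x] nn[of x] by simp
        qed simp
      qed
    qed
    finally show "(LINT x|lebesgue_on \<Omega>. B x \<bullet> grad \<phi> x) \<le> 0" by simp
  qed
  then show ?thesis
    by (simp add: z_def)
qed

theorem theorem2p1:
  fixes \<Omega> :: "(real^2) set" and m :: nat and D :: "nat \<Rightarrow> (real^2) set"
    and A :: "real^2 \<Rightarrow> real^2^2" and V u v Lv :: "real^2 \<Rightarrow> real"
  assumes "polygonal_domain \<Omega>"
    and "polygonal_partition \<Omega> m D"
    and "\<forall>k\<in>{1..m}. \<forall>i j. smooth_up_to_closure (D k) (\<lambda>x. A x $ i $ j)"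
    and "\<forall>k\<in>{1..m}. smooth_up_to_closure (D k) V"
    and "\<forall>x\<in>\<Omega>. transpose (A x) = A x"
    and "\<exists>\<alpha>>0. AE x in lebesgue_on \<Omega>. \<forall>\<xi>. \<xi> \<bullet> (A x *v \<xi>) \<ge> \<alpha> * (norm \<xi>)\<^sup>2"
    and "\<forall>x\<in>\<Omega>. V x \<ge> 0"
    and "landscape_function \<Omega> A V u"
    and "continuous_on (closure \<Omega>) v"
    and "Linf_on \<Omega> Lv"
    and "weak_L_eq \<Omega> A V v Lv"
  shows "\<forall>x\<in>closure \<Omega>. \<bar>v x\<bar> \<le> Linf_norm_boundary \<Omega> v + Linf_norm \<Omega> Lv * u x"
proof
  fix x assume x: "x \<in> closure \<Omega>"
  let ?M = "Linf_norm_boundary \<Omega> v" and ?F = "Linf_norm \<Omega> Lv"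
  have \<Omega>: "open \<Omega>" "bounded \<Omega>" "\<Omega> \<noteq> {}"
    using assms(1) by (auto simp: polygonal_domain_def)
  have A: "Linf_on \<Omega> (\<lambda>x. A x $ i $ j)" for i j
    by (rule Linf_on_piecewise_smooth[OF assms(1,2)]) (use assms(3) in blast)
  have V: "Linf_on \<Omega> V"
    by (rule Linf_on_piecewise_smooth[OF assms(1,2)]) (use assms(4) in blast)
  obtain \<alpha> where \<alpha>: "0 < \<alpha>" "AE x in lebesgue_on \<Omega>. \<forall>\<xi>. \<xi> \<bullet> (A x *v \<xi>) \<ge> \<alpha> * (norm \<xi>)\<^sup>2"
    using assms(6) by blast
  have u: "weak_L_eq \<Omega> A V u (\<lambda>x. 1)" "continuous_on (closure \<Omega>) u"
    "\<And>x. x \<in> frontier \<Omega> \<Longrightarrow> u x = 0"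
    using assms(8) by (auto simp: landscape_function_def)
  have bdry: "\<bar>v y\<bar> \<le> ?M + ?F * u y" if "y \<in> frontier \<Omega>" for y
    using abs_le_Linf_norm_boundary[OF assms(1,9) that] u(3)[OF that] by simp
  have signed: "s * v x \<le> ?M + ?F * u x" if s: "s = 1 \<or> s = - 1" and "x \<in> \<Omega>" for s
  proof (rule subsolution_le_landscape[OF \<Omega>(1,2) A V _ \<alpha> u(1,2) assms(11,9,10) _ _ _ that(2)])
    show "0 \<le> V x" if "x \<in> \<Omega>" for x using assms(7) that by blast
    show "AE x in lebesgue_on \<Omega>. s * Lv x \<le> ?F"
      using AE_abs_le_Linf_norm[OF assms(10) \<Omega>(1,3)] by eventually_elim (use s in auto)
    show "0 \<le> ?M" by (rule Linf_norm_boundary_nonneg[OF assms(1,9)])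
    show "s * v y \<le> ?M + ?F * u y" if "y \<in> frontier \<Omega>" for y
      using bdry[OF that] s by auto
  qed
  show "\<bar>v x\<bar> \<le> ?M + ?F * u x"
  proof (cases "x \<in> \<Omega>")
    case True
    then show ?thesis using signed[of 1] signed[of "- 1"] by (simp add: abs_le_iff)
  next
    case False
    then have "x \<in> frontier \<Omega>" using x \<Omega>(1) by (simp add: frontier_def interior_open)
    then show ?thesis by (rule bdry)
  qed
qed

end
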